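(* Let $G$ be an infinite, compact, totally disconnected monothetic group (equivalently $G\cong\mathbb{Z}/N\mathbb{Z}$ for an infinite supernatural number $N$). Then for every derivation $\delta:\mathcal{B}\to B$ there exists a derivation $d:\mathcal{A}\to A$ which lifts $\delta$, i.e. such that $\pi(d(a))=\delta(\pi(a))$ for all $a\in\mathcal{A}$.
   Context: Setup: $G$ is an infinite compact (Hausdorff) abelian group, written additively, and $x_1\in G$ generates a dense cyclic subgroup; put $x_n=nx_1$ ($n\in\mathbb{Z}$) and $\varphi(x)=x+x_1$. $\widehat G$ is the group of continuous characters $G\to S^1$, and $\mathcal{F}$ is the linear span of $\widehat G$ in $C(G)$. Let $H=\ell^2(\mathbb{Z})$ with canonical basis $\{E_l\}_{l\in\mathbb{Z}}$ and $H_+=\ell^2(\mathbb{Z}_{\ge 0})$ with canonical basis $\{E_k^+\}_{k\ge0}$. Define $VE_l=E_{l+1}$, $UE_k^+=E_{k+1}^+$, $M_fE_l=f(x_l)E_l$ and $M^+_fE^+_k=f(x_k)E^+_k$ for $f\in C(G)$. Let $A=C^*(U,M^+_f: f\in C(G))\subseteq B(H_+)$, $B=C^*(V,M_f:f\in C(G))\subseteq B(H)$, let $\mathcal{A}$ be the $*$-subalgebra generated by $U,U^*$ and $M^+_\chi$ ($\chi\in\widehat G$), and let $\mathcal{B}$ be the $*$-subalgebra generated by $V,V^{-1}$ and $M_\chi$ ($\chi\in\widehat G$). A derivation $d:\mathcal{A}\to A$ is a linear map with $d(ab)=ad(b)+d(a)b$ for $a,b\in\mathcal{A}$ (similarly for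 $\mathcal{B}\to B$). $\mathcal{K}$ denotes the compact operators on $H_+$; $\mathcal{K}\subseteq A$ is an ideal, and $\pi:A\to B$ denotes the surjective $*$-homomorphism with kernel $\mathcal{K}$ determined by $\pi(U)=V$, $\pi(M^+_f)=M_f$; it maps $\mathcal{A}$ onto $\mathcal{B}$. *)

theory Defs
  imports "HOL-Analysis.Analysis"
begin

definition zmul :: "int \<Rightarrow> 'a::ab_group_add \<Rightarrow> 'a" where
  "zmul n x = (if 0 \<le> n then (\<Sum>_\<in>{..<nat n}. x) else - (\<Sum>_\<in>{..<nat (- n)}. x))"

definition totally_disconnected_space :: "'a::topological_space itself \<Rightarrow> bool" where
  "totally_disconnected_space _ \<longleftrightarrow> (\<forall>S::'a set. connected S \<longrightarrow> (\<exists>a. S \<subseteq> {a}))"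

definition character :: "('a::topological_ab_group_add \<Rightarrow> complex) \<Rightarrow> bool" where
  "character ch \<longleftrightarrow> continuous_on UNIV ch \<and> (\<forall>x. norm (ch x) = 1)
      \<and> (\<forall>x y. ch (x + y) = ch x * ch y)"

text \<open>An operator T on l2(I) (I = nat for H_+, I = int for H) is represented by its matrix
  T i j = <E_i, T E_j>.  Vectors are functions I \<Rightarrow> complex.\<close>

type_synonym 'i mat = "'i \<Rightarrow> 'i \<Rightarrow> complex"

definition fin_supp :: "('i \<Rightarrow> complex) \<Rightarrow> bool" where
  "fin_supp x \<longleftrightarrow> finite {j. x j \<noteq> 0}"

definition l2norm :: "('i \<Rightarrow> complex) \<Rightarrow> real" where
  "l2norm x = sqrt (infsum (\<lambda>i. (cmod (x i))\<^sup>2) UNIV)"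

definition is_l2 :: "('i \<Rightarrow> complex) \<Rightarrow> bool" where
  "is_l2 x \<longleftrightarrow> (\<lambda>i. (cmod (x i))\<^sup>2) summable_on UNIV"

definition mat_app :: "'i mat \<Rightarrow> ('i \<Rightarrow> complex) \<Rightarrow> ('i \<Rightarrow> complex)" where
  "mat_app T x = (\<lambda>i. \<Sum>j\<in>{j. x j \<noteq> 0}. T i j * x j)"

definition bounded_op :: "'i mat \<Rightarrow> bool" where
  "bounded_op T \<longleftrightarrow> (\<exists>C. \<forall>x. fin_supp x \<longrightarrow>
      is_l2 (mat_app T x) \<and> l2norm (mat_app T x) \<le> C * l2norm x)"

text \<open>Operator norm (computed on the dense subspace of finitely supported vectors).\<close>
definition opnorm :: "'i mat \<Rightarrow> real" where
  "opnorm T = (SUP x\<in>{x. fin_supp x \<and> l2norm x \<le> 1}. l2norm (mat_app T x))"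

definition mat_add :: "'i mat \<Rightarrow> 'i mat \<Rightarrow> 'i mat" where
  "mat_add S T = (\<lambda>i j. S i j + T i j)"

definition mat_diff :: "'i mat \<Rightarrow> 'i mat \<Rightarrow> 'i mat" where
  "mat_diff S T = (\<lambda>i j. S i j - T i j)"

definition mat_scale :: "complex \<Rightarrow> 'i mat \<Rightarrow> 'i mat" where
  "mat_scale c T = (\<lambda>i j. c * T i j)"

text \<open>Composition S T (for bounded operators the series converges absolutely).\<close>
definition mat_mult :: "'i mat \<Rightarrow> 'i mat \<Rightarrow> 'i mat" where
  "mat_mult S T = (\<lambda>i j. infsum (\<lambda>k. S i k * T k j) UNIV)"

definition mat_adj :: "'i mat \<Rightarrow> 'i mat" where
  "mat_adj T = (\<lambda>i j. cnj (T j i))"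

definition mat_zero :: "'i mat" where
  "mat_zero = (\<lambda>i j. 0)"

inductive_set star_alg :: "'i mat set \<Rightarrow> 'i mat set" for S where
  gen: "T \<in> S \<Longrightarrow> T \<in> star_alg S"
| add: "T \<in> star_alg S \<Longrightarrow> T' \<in> star_alg S \<Longrightarrow> mat_add T T' \<in> star_alg S"
| scale: "T \<in> star_alg S \<Longrightarrow> mat_scale c T \<in> star_alg S"
| mult: "T \<in> star_alg S \<Longrightarrow> T' \<in> star_alg S \<Longrightarrow> mat_mult T T' \<in> star_alg S"
| adj: "T \<in> star_alg S \<Longrightarrow> mat_adj T \<in> star_alg S"

definition norm_closure :: "'i mat set \<Rightarrow> 'i mat set" where
  "norm_closure S = {T. bounded_op T \<and>
      (\<forall>e>0. \<exists>T'\<in>S. bounded_op T' \<and> opnorm (mat_diff T T') < e)}"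

definition cstar_gen :: "'i mat set \<Rightarrow> 'i mat set" where
  "cstar_gen S = norm_closure (star_alg S)"

definition compact_ops :: "'i mat set" where
  "compact_ops = norm_closure {T. bounded_op T \<and> finite {(i,j). T i j \<noteq> 0}}"

definition orb :: "'a::ab_group_add \<Rightarrow> int \<Rightarrow> 'a" where
  "orb x1 n = zmul n x1"

definition Ushift :: "nat mat" where
  "Ushift = (\<lambda>i j. if i = Suc j then 1 else 0)"

definition Vshift :: "int mat" where
  "Vshift = (\<lambda>i j. if i = j + 1 then 1 else 0)"

definition Vshift_inv :: "int mat" where
  "Vshift_inv = (\<lambda>i j. if j = i + 1 then 1 else 0)"

definition Mplus :: "'a::ab_group_add \<Rightarrow> ('a \<Rightarrow> complex) \<Rightarrow> nat mat" where
  "Mplus x1 f = (\<lambda>i j. if i = j then f (orb x1 (int i)) else 0)"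

definition Mfull :: "'a::ab_group_add \<Rightarrow> ('a \<Rightarrow> complex) \<Rightarrow> int mat" where
  "Mfull x1 f = (\<lambda>i j. if i = j then f (orb x1 i) else 0)"

definition Aalg :: "'a::topological_ab_group_add \<Rightarrow> nat mat set" where
  "Aalg x1 = cstar_gen ({Ushift} \<union> {Mplus x1 f | f. continuous_on UNIV f})"

definition Balg :: "'a::topological_ab_group_add \<Rightarrow> int mat set" where
  "Balg x1 = cstar_gen ({Vshift} \<union> {Mfull x1 f | f. continuous_on UNIV f})"

definition Aalg0 :: "'a::topological_ab_group_add \<Rightarrow> nat mat set" where
  "Aalg0 x1 = star_alg ({Ushift, mat_adj Ushift} \<union> {Mplus x1 ch | ch. character ch})"

definition Balg0 :: "'a::topological_ab_group_add \<Rightarrow> int mat set" where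
  "Balg0 x1 = star_alg ({Vshift, Vshift_inv} \<union> {Mfull x1 ch | ch. character ch})"

definition is_derivation :: "'i mat set \<Rightarrow> 'i mat set \<Rightarrow> ('i mat \<Rightarrow> 'i mat) \<Rightarrow> bool" where
  "is_derivation D E d \<longleftrightarrow>
     (\<forall>a\<in>D. d a \<in> E) \<and>
     (\<forall>a\<in>D. \<forall>b\<in>D. d (mat_add a b) = mat_add (d a) (d b)) \<and>
     (\<forall>a\<in>D. \<forall>c. d (mat_scale c a) = mat_scale c (d a)) \<and>
     (\<forall>a\<in>D. \<forall>b\<in>D. d (mat_mult a b) = mat_add (mat_mult a (d b)) (mat_mult (d a) b))"

text \<open>The quotient map pi : A \<rightarrow> B: the *-homomorphism with kernel the compacts,
  pi(U) = V, pi(M^+_f) = M_f.  (It is unique, since *-homomorphisms between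
  C*-algebras are automatically contractive.)\<close>
definition is_symbol_map :: "'a::topological_ab_group_add \<Rightarrow> (nat mat \<Rightarrow> int mat) \<Rightarrow> bool" where
  "is_symbol_map x1 \<pi> \<longleftrightarrow>
     \<pi> ` Aalg x1 = Balg x1 \<and>
     (\<forall>a\<in>Aalg x1. \<forall>b\<in>Aalg x1. \<pi> (mat_add a b) = mat_add (\<pi> a) (\<pi> b)) \<and>
     (\<forall>a\<in>Aalg x1. \<forall>c. \<pi> (mat_scale c a) = mat_scale c (\<pi> a)) \<and>
     (\<forall>a\<in>Aalg x1. \<forall>b\<in>Aalg x1. \<pi> (mat_mult a b) = mat_mult (\<pi> a) (\<pi> b)) \<and>
     (\<forall>a\<in>Aalg x1. \<pi> (mat_adj a) = mat_adj (\<pi> a)) \<and>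
     {a\<in>Aalg x1. \<pi> a = mat_zero} = compact_ops \<and>
     \<pi> Ushift = Vshift \<and>
     (\<forall>f. continuous_on UNIV f \<longrightarrow> \<pi> (Mplus x1 f) = Mfull x1 f)"

end

theory Submission
  imports Defs
begin

text \<open>Since G is totally disconnected, every character has finite order, so the dual group is an
  increasing union of finite groups F n. Averaging \<open>\<delta>(M_z) M_z^(-1)\<close> over F n gives an element b n
  that implements \<open>\<delta>\<close> on the M_z with z in F n, and b (n+1) - b n commutes with those M_z. Moreover
  \<open>[b n, V] = \<delta>(V) - E n (\<delta>(V))\<close>, where E n keeps the diagonals fixed by F n, and E n converges
  pointwise in norm on the algebra. Lift the increments b (n+1) - b n to A, keeping their
  commutation with F n, and multiply them on both sides by diagonal weights growing slowly from 0 to 1. This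
  changes the lifts by compact operators only, but makes the commutators with U absolutely summable.
  The sum of the weighted increments is an infinite matrix, in general unbounded, whose
  commutator with U is in A; a further matrix commuting with all M_z accounts for the remaining
  part of \<open>\<delta>(V)\<close>. Elements of the dense algebra are banded, so commutators with arbitrary infinite
  matrices make sense on it and satisfy the Leibniz rule; this commutator is the lift.\<close>

section \<open>Norm bounds through finite bilinear forms\<close>

text \<open>The elements b n need not converge, and V is unitary while U is only an isometry. The
  commutators of the increments with V tend to 0, but a lift a of an increment satisfies the
  corresponding relation with U only up to a compact operator k of uncontrolled norm, so the lifts
  cannot simply be summed. For a diagonal weight w, the commutator [w a w, U] differs from w [a, U]
  w by a term of size at most twice the slope of w times the norm of a, and w k w is small once w
  vanishes on the support of a finite approximant of k. Hence the weights have to start late and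
  rise slowly; as they reach 1 after finitely many steps, 1 - w has finite rank and the symbol is
  unchanged. The late start also makes the sum of the weighted increments finite in each entry. The
  sum need not be a bounded operator. This does no harm on M_z with z in a fixed finite group: all
  later increments commute with M_z, so the commutator is the same as that with a finite partial
  sum, an element of A. The diagonals of \<delta>(V) that no averaging removes are handled by
  solving the commutator equation with U along each diagonal.\<close>

definition mat_bound :: "'i mat \<Rightarrow> real \<Rightarrow> bool" where
  "mat_bound T C \<longleftrightarrow> 0 \<le> C \<and>
     (\<forall>I J x y. finite I \<longrightarrow> finite J \<longrightarrow>
        cmod (\<Sum>i\<in>I. \<Sum>j\<in>J. y i * T i j * x j)
          \<le> C * L2_set (\<lambda>i. cmod (y i)) I * L2_set (\<lambda>j. cmod (x j)) J)"

lemma mat_boundI: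
  assumes "0 \<le> C"
    and "\<And>I J x y. finite I \<Longrightarrow> finite J \<Longrightarrow>
      cmod (\<Sum>i\<in>I. \<Sum>j\<in>J. y i * T i j * x j)
        \<le> C * L2_set (\<lambda>i. cmod (y i)) I * L2_set (\<lambda>j. cmod (x j)) J"
  shows "mat_bound T C"
  using assms by (simp add: mat_bound_def)

lemma mat_boundD:
  "mat_bound T C \<Longrightarrow> finite I \<Longrightarrow> finite J \<Longrightarrow>
    cmod (\<Sum>i\<in>I. \<Sum>j\<in>J. y i * T i j * x j)
      \<le> C * L2_set (\<lambda>i. cmod (y i)) I * L2_set (\<lambda>j. cmod (x j)) J"
  by (simp add: mat_bound_def)

lemma mat_bound_nonneg: "mat_bound T C \<Longrightarrow> 0 \<le> C"
  by (simp add: mat_bound_def)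

lemma mat_bound_mono:
  assumes "mat_bound T C" "C \<le> D"
  shows "mat_bound T D"
proof (rule mat_boundI)
  show "0 \<le> D"
    using assms mat_bound_nonneg by fastforce
  fix I J :: "'a set" and x y :: "'a \<Rightarrow> complex"
  assume "finite I" "finite J"
  then have "cmod (\<Sum>i\<in>I. \<Sum>j\<in>J. y i * T i j * x j)
      \<le> C * (L2_set (\<lambda>i. cmod (y i)) I * L2_set (\<lambda>j. cmod (x j)) J)"
    using mat_boundD[OF assms(1)] by (simp add: mult.assoc)
  also have "\<dots> \<le> D * (L2_set (\<lambda>i. cmod (y i)) I * L2_set (\<lambda>j. cmod (x j)) J)"
    using assms(2) by (intro mult_right_mono) auto
  finally show "cmod (\<Sum>i\<in>I. \<Sum>j\<in>J. y i * T i j * x j)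
      \<le> D * L2_set (\<lambda>i. cmod (y i)) I * L2_set (\<lambda>j. cmod (x j)) J"
    by (simp add: mult.assoc)
qed

lemma mat_bound_entry:
  assumes "mat_bound T C"
  shows "cmod (T i j) \<le> C"
  using mat_boundD[OF assms, of "{i}" "{j}" "\<lambda>_. 1" "\<lambda>_. 1"] by simp

lemma L2_set_sq: "(L2_set f A)\<^sup>2 = (\<Sum>i\<in>A. (f i)\<^sup>2)"
  by (simp add: L2_set_def sum_nonneg)

lemma le_if_sq_le_mult:
  fixes a b :: real
  assumes "0 \<le> a" "0 \<le> b" "a\<^sup>2 \<le> b * a"
  shows "a \<le> b"
  using assms by (cases "a = 0") (auto simp: power2_eq_square)

text \<open>Test the bilinear form against the conjugate of the image vector v: this gives |v|^2 <=
  C |x| |v|, and one factor |v| cancels.\<close>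

lemma mat_bound_app_right:
  assumes "mat_bound T C" "finite K" "finite J"
  shows "L2_set (\<lambda>k. cmod (\<Sum>j\<in>J. T k j * x j)) K \<le> C * L2_set (\<lambda>j. cmod (x j)) J"
proof (rule le_if_sq_le_mult)
  define v where "v k = (\<Sum>j\<in>J. T k j * x j)" for k
  have "(L2_set (\<lambda>k. cmod (v k)) K)\<^sup>2 = cmod (\<Sum>k\<in>K. of_real ((cmod (v k))\<^sup>2))"
    unfolding L2_set_sq by (simp only: norm_of_real abs_of_nonneg sum_nonneg zero_le_power2 flip: of_real_sum)
  also have "(\<Sum>k\<in>K. of_real ((cmod (v k))\<^sup>2)) = (\<Sum>k\<in>K. \<Sum>j\<in>J. cnj (v k) * T k j * x j)"
  proof (rule sum.cong[OF refl])
    fix k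
    have "of_real ((cmod (v k))\<^sup>2) = cnj (v k) * v k"
      unfolding complex_norm_square by (rule mult.commute)
    also have "\<dots> = (\<Sum>j\<in>J. cnj (v k) * T k j * x j)"
      by (simp add: v_def[of k] sum_distrib_left mult.assoc del: cnj_sum)
    finally show "of_real ((cmod (v k))\<^sup>2) = (\<Sum>j\<in>J. cnj (v k) * T k j * x j)" .
  qed
  also have "cmod \<dots> \<le> C * L2_set (\<lambda>k. cmod (cnj (v k))) K * L2_set (\<lambda>j. cmod (x j)) J"
    by (rule mat_boundD[OF assms])
  finally show "(L2_set (\<lambda>k. cmod (\<Sum>j\<in>J. T k j * x j)) K)\<^sup>2
      \<le> C * L2_set (\<lambda>j. cmod (x j)) J * L2_set (\<lambda>k. cmod (\<Sum>j\<in>J. T k j * x j)) K"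
    unfolding v_def[symmetric] by (simp add: mult_ac)
qed (use mat_bound_nonneg[OF assms(1)] in auto)

lemma mat_bound_transpose:
  assumes "mat_bound T C"
  shows "mat_bound (\<lambda>i j. T j i) C"
proof (rule mat_boundI)
  show "0 \<le> C" by (rule mat_bound_nonneg[OF assms])
  fix I J :: "'a set" and x y :: "'a \<Rightarrow> complex"
  assume "finite I" "finite J"
  have "(\<Sum>i\<in>I. \<Sum>j\<in>J. y i * T j i * x j) = (\<Sum>j\<in>J. \<Sum>i\<in>I. x j * T j i * y i)"
    by (subst sum.swap) (simp add: mult_ac)
  then show "cmod (\<Sum>i\<in>I. \<Sum>j\<in>J. y i * T j i * x j)
      \<le> C * L2_set (\<lambda>i. cmod (y i)) I * L2_set (\<lambda>j. cmod (x j)) J"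
    using mat_boundD[OF assms \<open>finite J\<close> \<open>finite I\<close>, of x y] by (simp add: mult_ac)
qed

lemma mat_bound_app_left:
  assumes "mat_bound T C" "finite K" "finite I"
  shows "L2_set (\<lambda>k. cmod (\<Sum>i\<in>I. y i * T i k)) K \<le> C * L2_set (\<lambda>i. cmod (y i)) I"
  using mat_bound_app_right[OF mat_bound_transpose[OF assms(1)] assms(2,3), of y]
  by (simp add: mult.commute)

lemma mat_bound_cnj:
  assumes "mat_bound T C"
  shows "mat_bound (\<lambda>i j. cnj (T i j)) C"
proof (rule mat_boundI)
  show "0 \<le> C" by (rule mat_bound_nonneg[OF assms])
  fix I J :: "'a set" and x y :: "'a \<Rightarrow> complex"
  assume fin: "finite I" "finite J"
  have "cmod (\<Sum>i\<in>I. \<Sum>j\<in>J. y i * cnj (T i j) * x j)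
      = cmod (cnj (\<Sum>i\<in>I. \<Sum>j\<in>J. y i * cnj (T i j) * x j))"
    by (rule complex_mod_cnj[symmetric])
  also have "cnj (\<Sum>i\<in>I. \<Sum>j\<in>J. y i * cnj (T i j) * x j)
      = (\<Sum>i\<in>I. \<Sum>j\<in>J. cnj (y i) * T i j * cnj (x j))"
    by simp
  finally show "cmod (\<Sum>i\<in>I. \<Sum>j\<in>J. y i * cnj (T i j) * x j)
      \<le> C * L2_set (\<lambda>i. cmod (y i)) I * L2_set (\<lambda>j. cmod (x j)) J"
    using mat_boundD[OF assms fin, of "\<lambda>i. cnj (y i)" "\<lambda>j. cnj (x j)"] by simp
qed

lemma mat_bound_adj: "mat_bound T C \<Longrightarrow> mat_bound (mat_adj T) C"
  unfolding mat_adj_def by (rule mat_bound_transpose[OF mat_bound_cnj])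

lemma mat_bound_add:
  assumes "mat_bound S C" "mat_bound T D"
  shows "mat_bound (mat_add S T) (C + D)"
proof (rule mat_boundI)
  show "0 \<le> C + D" using mat_bound_nonneg[OF assms(1)] mat_bound_nonneg[OF assms(2)] by simp
  fix I J :: "'a set" and x y :: "'a \<Rightarrow> complex"
  assume fin: "finite I" "finite J"
  have "(\<Sum>i\<in>I. \<Sum>j\<in>J. y i * mat_add S T i j * x j)
      = (\<Sum>i\<in>I. \<Sum>j\<in>J. y i * S i j * x j) + (\<Sum>i\<in>I. \<Sum>j\<in>J. y i * T i j * x j)"
    by (simp add: mat_add_def algebra_simps sum.distrib)
  then show "cmod (\<Sum>i\<in>I. \<Sum>j\<in>J. y i * mat_add S T i j * x j)
      \<le> (C + D) * L2_set (\<lambda>i. cmod (y i)) I * L2_set (\<lambda>j. cmod (x j)) J"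
    using mat_boundD[OF assms(1) fin, of y x] mat_boundD[OF assms(2) fin, of y x]
      norm_triangle_ineq[of "\<Sum>i\<in>I. \<Sum>j\<in>J. y i * S i j * x j" "\<Sum>i\<in>I. \<Sum>j\<in>J. y i * T i j * x j"]
    by (simp add: distrib_right)
qed

lemma mat_bound_diag:
  assumes "mat_bound T C" "0 \<le> a" "0 \<le> b"
    and "\<And>i. cmod (u i) \<le> a" "\<And>j. cmod (v j) \<le> b"
  shows "mat_bound (\<lambda>i j. u i * T i j * v j) (a * C * b)"
proof (rule mat_boundI)
  note C = mat_bound_nonneg[OF assms(1)]
  show "0 \<le> a * C * b" using assms(2,3) C by simp
  fix I J :: "'a set" and x y :: "'a \<Rightarrow> complex"
  assume fin: "finite I" "finite J"
  have le: "L2_set (\<lambda>i. cmod (w i * z i)) A \<le> c * L2_set (\<lambda>i. cmod (z i)) A"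
    if "\<And>i. cmod (w i) \<le> c" "0 \<le> c" for w z :: "'a \<Rightarrow> complex" and c A
    using that by (auto simp: L2_set_right_distrib norm_mult intro!: L2_set_mono mult_right_mono)
  have "cmod (\<Sum>i\<in>I. \<Sum>j\<in>J. y i * (u i * T i j * v j) * x j)
      = cmod (\<Sum>i\<in>I. \<Sum>j\<in>J. (u i * y i) * T i j * (v j * x j))"
    by (simp add: mult_ac)
  also have "\<dots> \<le> C * L2_set (\<lambda>i. cmod (u i * y i)) I * L2_set (\<lambda>j. cmod (v j * x j)) J"
    by (rule mat_boundD[OF assms(1) fin])
  also have "\<dots> \<le> C * (a * L2_set (\<lambda>i. cmod (y i)) I) * (b * L2_set (\<lambda>j. cmod (x j)) J)"
    using C assms by (intro mult_mono le mult_nonneg_nonneg) auto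
  finally show "cmod (\<Sum>i\<in>I. \<Sum>j\<in>J. y i * (u i * T i j * v j) * x j)
      \<le> a * C * b * L2_set (\<lambda>i. cmod (y i)) I * L2_set (\<lambda>j. cmod (x j)) J"
    by (simp add: mult_ac)
qed

lemma mat_bound_scale: "mat_bound T C \<Longrightarrow> mat_bound (mat_scale c T) (cmod c * C)"
  using mat_bound_diag[of T C "cmod c" 1 "\<lambda>_. c" "\<lambda>_. 1"] by (simp add: mat_scale_def)

lemma mat_bound_uminus: "mat_bound T C \<Longrightarrow> mat_bound (\<lambda>i j. - T i j) C"
  using mat_bound_scale[of T C "-1"] by (simp add: mat_scale_def)

lemma mat_diff_conv: "mat_diff S T = mat_add S (mat_scale (-1) T)"
  by (simp add: mat_diff_def mat_add_def mat_scale_def)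

lemma mat_bound_diff: "mat_bound S C \<Longrightarrow> mat_bound T D \<Longrightarrow> mat_bound (mat_diff S T) (C + D)"
  using mat_bound_add[OF _ mat_bound_scale[of T D "-1"]] by (simp add: mat_diff_conv)

lemma mat_bound_diff_commute: "mat_bound (mat_diff S T) C \<Longrightarrow> mat_bound (mat_diff T S) C"
  using mat_bound_uminus[of "mat_diff S T" C] by (simp add: mat_diff_def)

lemma mat_bound_diff_trans:
  assumes "mat_bound (mat_diff R S) C" "mat_bound (mat_diff S T) D"
  shows "mat_bound (mat_diff R T) (C + D)"
  using mat_bound_add[OF assms] by (simp add: mat_diff_def mat_add_def)

text \<open>Each instance of the bound involves finitely many entries, so it survives entrywise
  limits. This is the benefit of testing norms on finite bilinear forms.\<close>

lemma mat_bound_limit: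
  assumes "\<And>i j. (\<lambda>n. T n i j) \<longlonglongrightarrow> S i j"
    and "eventually (\<lambda>n. mat_bound (T n) C) sequentially"
  shows "mat_bound S C"
proof (rule mat_boundI)
  from eventually_happens[OF assms(2)] show "0 \<le> C"
    by (auto dest: mat_bound_nonneg)
  fix I J :: "'a set" and x y :: "'a \<Rightarrow> complex"
  assume fin: "finite I" "finite J"
  show "cmod (\<Sum>i\<in>I. \<Sum>j\<in>J. y i * S i j * x j)
      \<le> C * L2_set (\<lambda>i. cmod (y i)) I * L2_set (\<lambda>j. cmod (x j)) J"
  proof (rule tendsto_upperbound)
    show "(\<lambda>n. cmod (\<Sum>i\<in>I. \<Sum>j\<in>J. y i * T n i j * x j))
        \<longlonglongrightarrow> cmod (\<Sum>i\<in>I. \<Sum>j\<in>J. y i * S i j * x j)"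
      by (intro tendsto_intros assms(1))
    show "eventually (\<lambda>n. cmod (\<Sum>i\<in>I. \<Sum>j\<in>J. y i * T n i j * x j)
        \<le> C * L2_set (\<lambda>i. cmod (y i)) I * L2_set (\<lambda>j. cmod (x j)) J) sequentially"
      using assms(2) by eventually_elim (rule mat_boundD[OF _ fin])
  qed simp
qed

lemma mat_bound_zero: "mat_bound mat_zero 0"
  by (rule mat_boundI) (auto simp: mat_zero_def)

text \<open>Every finite piece of a row of S has norm at most C and every finite piece of a column
  of T norm at most D; Cauchy-Schwarz bounds the partial sums.\<close>

lemma mat_bound_summable:
  assumes "mat_bound S C" "mat_bound T D"
  shows "(\<lambda>k. S i k * T k j) summable_on UNIV"
proof (rule abs_summable_summable, rule nonneg_bdd_above_summable_on)
  show "bdd_above (sum (\<lambda>k. cmod (S i k * T k j)) ` {F. F \<subseteq> UNIV \<and> finite F})"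
  proof (rule bdd_aboveI2)
    fix F assume "F \<in> {F. F \<subseteq> (UNIV :: 'a set) \<and> finite F}"
    then have F: "finite F" by simp
    have "(\<Sum>k\<in>F. cmod (S i k * T k j)) = (\<Sum>k\<in>F. \<bar>cmod (S i k)\<bar> * \<bar>cmod (T k j)\<bar>)"
      by (simp add: norm_mult)
    also have "\<dots> \<le> L2_set (\<lambda>k. cmod (S i k)) F * L2_set (\<lambda>k. cmod (T k j)) F"
      by (rule L2_set_mult_ineq)
    also have "\<dots> \<le> C * D"
      using mat_bound_app_left[OF assms(1) F, of "{i}" "\<lambda>_. 1"]
        mat_bound_app_right[OF assms(2) F, of "{j}" "\<lambda>_. 1"] mat_bound_nonneg[OF assms(1)]
      by (intro mult_mono) auto
    finally show "(\<Sum>k\<in>F. cmod (S i k * T k j)) \<le> C * D" .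
  qed
qed auto

lemma has_sum_finite_sum:
  fixes f :: "'b \<Rightarrow> 'a \<Rightarrow> 'c::topological_comm_monoid_add"
  assumes "\<And>i. i \<in> I \<Longrightarrow> (f i has_sum s i) A"
  shows "((\<lambda>k. \<Sum>i\<in>I. f i k) has_sum (\<Sum>i\<in>I. s i)) A"
  using assms by (induction I rule: infinite_finite_induct) (auto intro: has_sum_add)

lemma mat_bound_mult:
  assumes S: "mat_bound S C" and T: "mat_bound T D"
  shows "mat_bound (mat_mult S T) (C * D)"
proof (rule mat_boundI)
  note CD = mat_bound_nonneg[OF S] mat_bound_nonneg[OF T]
  show "0 \<le> C * D" using CD by simp
  fix I J :: "'a set" and x y :: "'a \<Rightarrow> complex"
  assume fin: "finite I" "finite J"
  \<comment> \<open>For fixed k the double sum over I and J factors as \<open>u k * v k\<close>, so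
    the partial sums over k are pairings of truncations of y S and T x.\<close>
  define u where "u k = (\<Sum>i\<in>I. y i * S i k)" for k
  define v where "v k = (\<Sum>j\<in>J. T k j * x j)" for k
  define f where "f k = (\<Sum>i\<in>I. \<Sum>j\<in>J. y i * (S i k * T k j) * x j)" for k
  have f: "f k = u k * v k" for k
    unfolding f_def u_def v_def sum_product by (simp add: mult.assoc)
  have hs: "((\<lambda>k. S i k * T k j) has_sum mat_mult S T i j) UNIV" for i j
    using mat_bound_summable[OF S T] by (simp add: mat_mult_def)
  have "(f has_sum (\<Sum>i\<in>I. \<Sum>j\<in>J. y i * mat_mult S T i j * x j)) UNIV"
    unfolding f_def
    by (intro has_sum_finite_sum has_sum_cmult_left has_sum_cmult_right hs)
  then have lim: "((\<lambda>F. cmod (sum f F)) \<longlongrightarrow> cmod (\<Sum>i\<in>I. \<Sum>j\<in>J. y i * mat_mult S T i j * x j))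
      (finite_subsets_at_top UNIV)"
    unfolding has_sum_def by (rule tendsto_norm)
  show "cmod (\<Sum>i\<in>I. \<Sum>j\<in>J. y i * mat_mult S T i j * x j)
      \<le> C * D * L2_set (\<lambda>i. cmod (y i)) I * L2_set (\<lambda>j. cmod (x j)) J"
  proof (rule tendsto_upperbound[OF lim])
    have "cmod (sum f F) \<le> C * D * L2_set (\<lambda>i. cmod (y i)) I * L2_set (\<lambda>j. cmod (x j)) J"
      if F: "finite F" for F
    proof -
      have "cmod (sum f F) \<le> (\<Sum>k\<in>F. \<bar>cmod (u k)\<bar> * \<bar>cmod (v k)\<bar>)"
        unfolding f by (rule order_trans[OF norm_sum]) (simp add: norm_mult)
      also have "\<dots> \<le> L2_set (\<lambda>k. cmod (u k)) F * L2_set (\<lambda>k. cmod (v k)) F"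
        by (rule L2_set_mult_ineq)
      also have "\<dots> \<le> (C * L2_set (\<lambda>i. cmod (y i)) I) * (D * L2_set (\<lambda>j. cmod (x j)) J)"
        unfolding u_def v_def using CD fin F
        by (intro mult_mono mat_bound_app_left[OF S] mat_bound_app_right[OF T] mult_nonneg_nonneg) auto
      finally show ?thesis by (simp add: mult_ac)
    qed
    then show "\<forall>\<^sub>F F in finite_subsets_at_top UNIV. cmod (sum f F)
        \<le> C * D * L2_set (\<lambda>i. cmod (y i)) I * L2_set (\<lambda>j. cmod (x j)) J"
      by (auto simp: eventually_finite_subsets_at_top)
  qed simp
qed

lemma mat_mult_diff_right:
  assumes "mat_bound R A" "mat_bound S B" "mat_bound T C"
  shows "mat_mult R (mat_diff S T) = mat_diff (mat_mult R S) (mat_mult R T)"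
  using infsum_add[OF mat_bound_summable[OF assms(1,2)]
      mat_bound_summable[OF assms(1) mat_bound_scale[OF assms(3), of "-1"]]]
  by (fastforce simp: mat_mult_def mat_diff_def mat_scale_def algebra_simps infsum_uminus)

lemma mat_mult_diff_left:
  assumes "mat_bound R A" "mat_bound S B" "mat_bound T C"
  shows "mat_mult (mat_diff S T) R = mat_diff (mat_mult S R) (mat_mult T R)"
  using infsum_add[OF mat_bound_summable[OF assms(2,1)]
      mat_bound_summable[OF mat_bound_scale[OF assms(3), of "-1"] assms(1)]]
  by (fastforce simp: mat_mult_def mat_diff_def mat_scale_def algebra_simps infsum_uminus)

lemma mat_adj_mult: "mat_adj (mat_mult S T) = mat_mult (mat_adj T) (mat_adj S)"
  by (simp add: mat_adj_def mat_mult_def mult.commute flip: infsum_cnj)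

section \<open>Comparison with \<open>bounded_op\<close>, \<open>opnorm\<close> and
  \<open>norm_closure\<close>\<close>

lemma l2norm_fin_supp:
  assumes "fin_supp x"
  shows "l2norm x = L2_set (\<lambda>j. cmod (x j)) {j. x j \<noteq> 0}"
proof -
  have "infsum (\<lambda>i. (cmod (x i))\<^sup>2) UNIV = infsum (\<lambda>i. (cmod (x i))\<^sup>2) {j. x j \<noteq> 0}"
    by (rule infsum_cong_neutral) auto
  then show ?thesis
    using assms by (simp add: l2norm_def L2_set_def fin_supp_def)
qed

lemma l2norm_nonneg: "0 \<le> l2norm x"
  by (simp add: l2norm_def infsum_nonneg)

text \<open>Forwards, \<open>mat_bound_app_right\<close> bounds all finite partial sums of the
  squared norm of T x. Backwards, x is cut off to J and Cauchy-Schwarz is applied over I.\<close>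

lemma mat_bound_iff:
  "mat_bound T C \<longleftrightarrow> 0 \<le> C \<and> (\<forall>x. fin_supp x \<longrightarrow>
      is_l2 (mat_app T x) \<and> l2norm (mat_app T x) \<le> C * l2norm x)"
proof (intro iffI conjI allI impI)
  assume T: "mat_bound T C"
  show C: "0 \<le> C" by (rule mat_bound_nonneg[OF T])
  fix x :: "'a \<Rightarrow> complex" assume x: "fin_supp x"
  then have fin: "finite {j. x j \<noteq> 0}" by (simp add: fin_supp_def)
  have le: "(\<Sum>i\<in>F. (cmod (mat_app T x i))\<^sup>2) \<le> (C * l2norm x)\<^sup>2" if "finite F" for F
    using power_mono[OF mat_bound_app_right[OF T that fin, of x], of 2]
    by (simp add: L2_set_sq l2norm_fin_supp[OF x] mat_app_def)
  show l2: "is_l2 (mat_app T x)"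
    unfolding is_l2_def
    by (rule nonneg_bdd_above_summable_on) (auto intro!: bdd_aboveI2 le)
  have "infsum (\<lambda>i. (cmod (mat_app T x i))\<^sup>2) UNIV \<le> (C * l2norm x)\<^sup>2"
    using l2 le unfolding is_l2_def by (intro infsum_le_finite_sums) auto
  then show "l2norm (mat_app T x) \<le> C * l2norm x"
    using C l2norm_nonneg[of x] by (subst l2norm_def) (auto intro: real_le_lsqrt)
next
  assume *: "0 \<le> C \<and> (\<forall>x. fin_supp x \<longrightarrow>
      is_l2 (mat_app T x) \<and> l2norm (mat_app T x) \<le> C * l2norm x)"
  show "mat_bound T C"
  proof (rule mat_boundI)
    show "0 \<le> C" using * by simp
    fix I J :: "'a set" and x y :: "'a \<Rightarrow> complex"
    assume fin: "finite I" "finite J"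
    define z where "z j = (if j \<in> J then x j else 0)" for j
    have sub: "{j. z j \<noteq> 0} \<subseteq> J" by (auto simp: z_def)
    have z: "fin_supp z"
      unfolding fin_supp_def using sub fin(2) finite_subset by blast
    have app: "mat_app T z i = (\<Sum>j\<in>J. T i j * x j)" for i
      unfolding mat_app_def by (rule sum.mono_neutral_cong_left[OF fin(2) sub]) (auto simp: z_def)
    have nz: "l2norm z = L2_set (\<lambda>j. cmod (x j)) J"
      unfolding l2norm_fin_supp[OF z] L2_set_def
      by (intro arg_cong[where f = sqrt] sum.mono_neutral_cong_left[OF fin(2) sub]) (auto simp: z_def)
    have l2: "(\<lambda>i. (cmod (mat_app T z i))\<^sup>2) summable_on UNIV"
      and le: "l2norm (mat_app T z) \<le> C * L2_set (\<lambda>j. cmod (x j)) J"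
      using * z by (auto simp: is_l2_def nz)
    have "L2_set (\<lambda>i. cmod (mat_app T z i)) I \<le> l2norm (mat_app T z)"
      unfolding L2_set_def l2norm_def
      by (rule real_sqrt_le_mono, rule finite_sum_le_infsum[OF l2 fin(1)]) auto
    then have le2: "L2_set (\<lambda>i. cmod (mat_app T z i)) I \<le> C * L2_set (\<lambda>j. cmod (x j)) J"
      using le by simp
    have "(\<Sum>i\<in>I. \<Sum>j\<in>J. y i * T i j * x j) = (\<Sum>i\<in>I. y i * mat_app T z i)"
      by (simp add: app sum_distrib_left mult.assoc)
    also have "cmod \<dots> \<le> (\<Sum>i\<in>I. \<bar>cmod (y i)\<bar> * \<bar>cmod (mat_app T z i)\<bar>)"
      by (rule order_trans[OF norm_sum]) (simp add: norm_mult)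
    also have "\<dots> \<le> L2_set (\<lambda>i. cmod (y i)) I * L2_set (\<lambda>i. cmod (mat_app T z i)) I"
      by (rule L2_set_mult_ineq)
    also have "\<dots> \<le> L2_set (\<lambda>i. cmod (y i)) I * (C * L2_set (\<lambda>j. cmod (x j)) J)"
      by (rule mult_left_mono[OF le2]) simp
    finally show "cmod (\<Sum>i\<in>I. \<Sum>j\<in>J. y i * T i j * x j)
        \<le> C * L2_set (\<lambda>i. cmod (y i)) I * L2_set (\<lambda>j. cmod (x j)) J"
      by (simp add: mult_ac)
  qed
qed

lemma bounded_op_iff: "bounded_op T \<longleftrightarrow> (\<exists>C. mat_bound T C)"
proof
  assume "bounded_op T"
  then obtain C where C: "\<And>x. fin_supp x \<Longrightarrow>
      is_l2 (mat_app T x) \<and> l2norm (mat_app T x) \<le> C * l2norm x"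
    by (auto simp: bounded_op_def)
  \<comment> \<open>\<open>bounded_op\<close> allows a negative constant, \<open>mat_bound\<close>
    does not.\<close>
  have "C * l2norm x \<le> max 0 C * l2norm x" for x :: "'a \<Rightarrow> complex"
    by (intro mult_right_mono l2norm_nonneg) simp
  then have "mat_bound T (max 0 C)"
    unfolding mat_bound_iff using C by (meson max.cobounded1 order_trans)
  then show "\<exists>C. mat_bound T C" ..
next
  assume "\<exists>C. mat_bound T C"
  then show "bounded_op T"
    unfolding mat_bound_iff bounded_op_def by blast
qed

lemma opnorm_le:
  assumes "mat_bound T C"
  shows "opnorm T \<le> C"
  unfolding opnorm_def
proof (rule cSUP_least)
  have "fin_supp (\<lambda>_. 0 :: complex)" "l2norm (\<lambda>_::'a. 0 :: complex) \<le> 1"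
    by (auto simp: fin_supp_def l2norm_def)
  then show "{x. fin_supp x \<and> l2norm (x :: 'a \<Rightarrow> complex) \<le> 1} \<noteq> {}" by blast
  fix x :: "'a \<Rightarrow> complex" assume "x \<in> {x. fin_supp x \<and> l2norm x \<le> 1}"
  then have "l2norm (mat_app T x) \<le> C * l2norm x" "C * l2norm x \<le> C * 1"
    using assms unfolding mat_bound_iff by (auto intro!: mult_left_mono simp del: mult_1_right)
  then show "l2norm (mat_app T x) \<le> C" by simp
qed

lemma l2norm_scale: "l2norm (\<lambda>i. c * x i) = cmod c * l2norm x"
  by (simp add: l2norm_def norm_mult power_mult_distrib infsum_cmult_right' real_sqrt_mult)

lemma mat_bound_opnorm:
  assumes "bounded_op T"
  shows "mat_bound T (opnorm T)"
proof -
  obtain C where C: "mat_bound T C" using assms by (auto simp: bounded_op_iff)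
  have bdd: "bdd_above ((\<lambda>x. l2norm (mat_app T x)) ` {x. fin_supp x \<and> l2norm x \<le> 1})"
  proof (rule bdd_aboveI2)
    fix x :: "'a \<Rightarrow> complex" assume "x \<in> {x. fin_supp x \<and> l2norm x \<le> 1}"
    then have "l2norm (mat_app T x) \<le> C * l2norm x" "C * l2norm x \<le> C * 1"
      using C unfolding mat_bound_iff by (auto intro!: mult_left_mono simp del: mult_1_right)
    then show "l2norm (mat_app T x) \<le> C" by simp
  qed
  have up: "l2norm (mat_app T x) \<le> opnorm T" if "fin_supp x" "l2norm x \<le> 1" for x
    unfolding opnorm_def using that by (intro cSUP_upper[OF _ bdd]) auto
  have z: "fin_supp (\<lambda>_::'a. 0 :: complex)" "l2norm (\<lambda>_::'a. 0 :: complex) \<le> 1"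
    by (auto simp: fin_supp_def l2norm_def)
  have nn: "0 \<le> opnorm T"
    using up[OF z] l2norm_nonneg[of "mat_app T (\<lambda>_. 0)"] by linarith
  have "l2norm (mat_app T x) \<le> opnorm T * l2norm x" if x: "fin_supp x" for x
  \<comment> \<open>A vector of norm 0 cannot be normalised; the bound C shows that its image has
    norm 0.\<close>
  proof (cases "l2norm x = 0")
    case True
    then show ?thesis
      using C x unfolding mat_bound_iff by (metis mult_zero_right)
  next
    case False
    then have pos: "0 < l2norm x" using l2norm_nonneg[of x] by simp
    define c where "c = complex_of_real (1 / l2norm x)"
    have c: "c \<noteq> 0" using pos by (simp add: c_def)
    have "mat_app T (\<lambda>i. c * x i) = (\<lambda>i. c * mat_app T x i)"
      using c by (simp add: mat_app_def sum_distrib_left mult_ac)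
    moreover have "fin_supp (\<lambda>i. c * x i)" using x c by (simp add: fin_supp_def)
    moreover have "l2norm (\<lambda>i. c * x i) \<le> 1" using pos l2norm_scale[of c x] by (simp add: c_def norm_divide)
    ultimately have "cmod c * l2norm (mat_app T x) \<le> opnorm T"
      using up[of "\<lambda>i. c * x i"] by (simp add: l2norm_scale)
    moreover have "cmod c = 1 / l2norm x"
      using pos unfolding c_def norm_of_real by simp
    ultimately show ?thesis using pos by (simp add: field_simps)
  qed
  then show ?thesis
    using nn C unfolding mat_bound_iff by blast
qed

text \<open>Trades the supremum in \<open>opnorm\<close> for \<open>mat_bound\<close>. Boundedness
  of T is recovered on the right: T is a bounded approximant plus a bounded difference.\<close>

lemma norm_closure_iff:
  "T \<in> norm_closure S \<longleftrightarrow> (\<forall>e>0. \<exists>T'\<in>S. bounded_op T' \<and> mat_bound (mat_diff T T') e)"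
proof
  assume T: "T \<in> norm_closure S"
  show "\<forall>e>0. \<exists>T'\<in>S. bounded_op T' \<and> mat_bound (mat_diff T T') e"
  proof (intro allI impI)
    fix e :: real assume "0 < e"
    then obtain T' where T': "T' \<in> S" "bounded_op T'" "opnorm (mat_diff T T') < e"
      using T by (auto simp: norm_closure_def)
    have "bounded_op (mat_diff T T')"
      using T T'(2) by (auto simp: norm_closure_def bounded_op_iff intro: mat_bound_diff)
    then have "mat_bound (mat_diff T T') e"
      using mat_bound_mono[OF mat_bound_opnorm] T'(3) by fastforce
    then show "\<exists>T'\<in>S. bounded_op T' \<and> mat_bound (mat_diff T T') e"
      using T' by blast
  qed
next
  assume *: "\<forall>e>0. \<exists>T'\<in>S. bounded_op T' \<and> mat_bound (mat_diff T T') e"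
  from this[rule_format, of 1] obtain T' where T': "bounded_op T'" "mat_bound (mat_diff T T') 1"
    by auto
  then obtain C where "mat_bound T' C" by (auto simp: bounded_op_iff)
  from mat_bound_add[OF T'(2) this] have "bounded_op T"
    by (auto simp: bounded_op_iff mat_add_def mat_diff_def)
  moreover have "\<exists>T'\<in>S. bounded_op T' \<and> opnorm (mat_diff T T') < e" if "0 < e" for e
  proof -
    obtain T' where "T' \<in> S" "bounded_op T'" "mat_bound (mat_diff T T') (e/2)"
      using *[rule_format, of "e/2"] \<open>0 < e\<close> by auto
    then show ?thesis
      using opnorm_le[of "mat_diff T T'" "e/2"] \<open>0 < e\<close> by (intro bexI[of _ T']) auto
  qed
  ultimately show "T \<in> norm_closure S"
    by (simp add: norm_closure_def)
qed

lemma norm_closure_closed: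
  assumes "\<And>e. 0 < e \<Longrightarrow> \<exists>T'\<in>norm_closure S. mat_bound (mat_diff T T') e"
  shows "T \<in> norm_closure S"
  unfolding norm_closure_iff
proof (intro allI impI)
  fix e :: real assume e: "0 < e"
  then obtain T' where T': "T' \<in> norm_closure S" "mat_bound (mat_diff T T') (e/2)"
    using assms[of "e/2"] by auto
  then obtain R where "R \<in> S" "bounded_op R" "mat_bound (mat_diff T' R) (e/2)"
    using e unfolding norm_closure_iff by (meson half_gt_zero)
  with mat_bound_diff_trans[OF T'(2)] show "\<exists>R\<in>S. bounded_op R \<and> mat_bound (mat_diff T R) e"
    by fastforce
qed

lemma norm_closure_superset:
  assumes "T \<in> S" "bounded_op T"
  shows "T \<in> norm_closure S"
proof -
  have "mat_diff T T = mat_zero" by (simp add: mat_diff_def mat_zero_def)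
  then show ?thesis
    unfolding norm_closure_iff using assms mat_bound_mono[OF mat_bound_zero]
    by (metis less_imp_le)
qed

lemma norm_closure_bounded: "T \<in> norm_closure S \<Longrightarrow> \<exists>C. mat_bound T C"
  by (simp add: norm_closure_def bounded_op_iff)

section \<open>Norm-closed star algebras\<close>

lemma star_alg_bounded:
  assumes "\<And>T. T \<in> S \<Longrightarrow> bounded_op T" "T \<in> star_alg S"
  shows "bounded_op T"
  using assms(2)
proof (induction rule: star_alg.induct)
  case (gen T)
  then show ?case by (rule assms(1))
qed (auto simp: bounded_op_iff intro: mat_bound_add mat_bound_scale mat_bound_mult mat_bound_adj)

lemma mat_diff_add_add:
  "mat_diff (mat_add S T) (mat_add S' T') = mat_add (mat_diff S S') (mat_diff T T')"
  by (simp add: mat_diff_def mat_add_def algebra_simps)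

lemma mat_diff_scale: "mat_diff (mat_scale c S) (mat_scale c T) = mat_scale c (mat_diff S T)"
  by (simp add: mat_diff_def mat_scale_def algebra_simps)

lemma mat_diff_adj: "mat_diff (mat_adj S) (mat_adj T) = mat_adj (mat_diff S T)"
  by (simp add: mat_diff_def mat_adj_def)

lemma norm_closure_add:
  assumes X: "\<And>S T. S \<in> X \<Longrightarrow> T \<in> X \<Longrightarrow> mat_add S T \<in> X"
    and ST: "S \<in> norm_closure X" "T \<in> norm_closure X"
  shows "mat_add S T \<in> norm_closure X"
  unfolding norm_closure_iff
proof (intro allI impI)
  fix e :: real assume "0 < e"
  then obtain S' T' where S': "S' \<in> X" "bounded_op S'" "mat_bound (mat_diff S S') (e/2)"
    and T': "T' \<in> X" "bounded_op T'" "mat_bound (mat_diff T T') (e/2)"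
    using ST unfolding norm_closure_iff by (meson half_gt_zero)
  have "mat_bound (mat_diff (mat_add S T) (mat_add S' T')) e"
    using mat_bound_add[OF S'(3) T'(3)] by (simp add: mat_diff_add_add)
  moreover have "bounded_op (mat_add S' T')"
    using S'(2) T'(2) by (auto simp: bounded_op_iff intro: mat_bound_add)
  ultimately show "\<exists>R\<in>X. bounded_op R \<and> mat_bound (mat_diff (mat_add S T) R) e"
    using X[OF S'(1) T'(1)] by blast
qed

lemma norm_closure_scale:
  assumes X: "\<And>S. S \<in> X \<Longrightarrow> mat_scale c S \<in> X" and S: "S \<in> norm_closure X"
  shows "mat_scale c S \<in> norm_closure X"
  unfolding norm_closure_iff
proof (intro allI impI)
  fix e :: real assume e: "0 < e"
  define r where "r = e / (cmod c + 1)"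
  have "0 < cmod c + 1" using norm_ge_zero[of c] by linarith
  then have r: "0 < r" "cmod c * r \<le> e"
    using e by (auto simp: r_def field_simps)
  then obtain S' where S': "S' \<in> X" "bounded_op S'" "mat_bound (mat_diff S S') r"
    using S unfolding norm_closure_iff by blast
  have "mat_bound (mat_diff (mat_scale c S) (mat_scale c S')) e"
    using mat_bound_mono[OF mat_bound_scale[OF S'(3)] r(2)] by (simp add: mat_diff_scale)
  moreover have "bounded_op (mat_scale c S')"
    using S'(2) by (auto simp: bounded_op_iff intro: mat_bound_scale)
  ultimately show "\<exists>R\<in>X. bounded_op R \<and> mat_bound (mat_diff (mat_scale c S) R) e"
    using X[OF S'(1)] by blast
qed

lemma norm_closure_adj:
  assumes X: "\<And>S. S \<in> X \<Longrightarrow> mat_adj S \<in> X" and S: "S \<in> norm_closure X"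
  shows "mat_adj S \<in> norm_closure X"
  unfolding norm_closure_iff
proof (intro allI impI)
  fix e :: real assume e: "0 < e"
  then obtain S' where S': "S' \<in> X" "bounded_op S'" "mat_bound (mat_diff S S') e"
    using S unfolding norm_closure_iff by blast
  have "mat_bound (mat_diff (mat_adj S) (mat_adj S')) e"
    using mat_bound_adj[OF S'(3)] by (simp add: mat_diff_adj)
  moreover have "bounded_op (mat_adj S')"
    using S'(2) by (auto simp: bounded_op_iff intro: mat_bound_adj)
  ultimately show "\<exists>R\<in>X. bounded_op R \<and> mat_bound (mat_diff (mat_adj S) R) e"
    using X[OF S'(1)] by blast
qed

lemma norm_closure_mult:
  assumes X: "\<And>S T. S \<in> X \<Longrightarrow> T \<in> X \<Longrightarrow> mat_mult S T \<in> X"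
    and ST: "S \<in> norm_closure X" "T \<in> norm_closure X"
  shows "mat_mult S T \<in> norm_closure X"
  unfolding norm_closure_iff
proof (intro allI impI)
  fix e :: real assume e: "0 < e"
  obtain C where C: "mat_bound S C" using norm_closure_bounded[OF ST(1)] by blast
  have C0: "0 \<le> C" by (rule mat_bound_nonneg[OF C])
  \<comment> \<open>In ST - S'T' = S(T - T') + (S - S')T' the second term involves a bound of T', so
    T' is chosen before the tolerance for S'.\<close>
  define r where "r = e / (2 * (C + 1))"
  have r: "0 < r" "C * r \<le> e/2" using e C0 by (auto simp: r_def field_simps)
  obtain T' where T': "T' \<in> X" "bounded_op T'" "mat_bound (mat_diff T T') r"
    using ST(2) r(1) unfolding norm_closure_iff by blast
  obtain D where D: "mat_bound T D" using norm_closure_bounded[OF ST(2)] by blast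
  obtain D' where D': "mat_bound T' D'" using T'(2) by (auto simp: bounded_op_iff)
  have D0: "0 \<le> D'" by (rule mat_bound_nonneg[OF D'])
  define r' where "r' = e / (2 * (D' + 1))"
  have r': "0 < r'" "r' * D' \<le> e/2" using e D0 by (auto simp: r'_def field_simps)
  obtain S' where S': "S' \<in> X" "bounded_op S'" "mat_bound (mat_diff S S') r'"
    using ST(1) r'(1) unfolding norm_closure_iff by blast
  obtain C' where C': "mat_bound S' C'" using S'(2) by (auto simp: bounded_op_iff)
  have "mat_diff (mat_mult S T) (mat_mult S' T')
      = mat_add (mat_mult S (mat_diff T T')) (mat_mult (mat_diff S S') T')"
    unfolding mat_mult_diff_right[OF C D D'] mat_mult_diff_left[OF D' C C']
    by (simp add: mat_diff_def mat_add_def)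
  moreover have "mat_bound \<dots> (e/2 + e/2)"
    by (intro mat_bound_add mat_bound_mono[OF mat_bound_mult[OF C T'(3)] r(2)]
        mat_bound_mono[OF mat_bound_mult[OF S'(3) D'] r'(2)])
  ultimately have "mat_bound (mat_diff (mat_mult S T) (mat_mult S' T')) e" by simp
  moreover have "bounded_op (mat_mult S' T')"
    using C' D' by (auto simp: bounded_op_iff intro: mat_bound_mult)
  ultimately show "\<exists>R\<in>X. bounded_op R \<and> mat_bound (mat_diff (mat_mult S T) R) e"
    using X[OF S'(1) T'(1)] by blast
qed

lemma mat_bound_sum:
  assumes "\<And>z. z \<in> F \<Longrightarrow> mat_bound (T z) (C z)"
  shows "mat_bound (\<lambda>i j. \<Sum>z\<in>F. T z i j) (\<Sum>z\<in>F. C z)"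
  using assms
proof (induction F rule: infinite_finite_induct)
  case (insert z F)
  then have "mat_bound (mat_add (T z) (\<lambda>i j. \<Sum>z\<in>F. T z i j)) (C z + (\<Sum>z\<in>F. C z))"
    by (intro mat_bound_add) auto
  then show ?case using insert.hyps by (simp add: mat_add_def)
qed (use mat_bound_zero in \<open>auto simp: mat_zero_def\<close>)

lemma mat_series_summable:
  assumes "\<And>l. mat_bound (T l) (C l)" "summable C"
  shows "summable (\<lambda>l. T l i j)"
  by (rule summable_comparison_test'[OF assms(2), of 0]) (use mat_bound_entry[OF assms(1)] in auto)

text \<open>Differences of partial sums are bounded by tails of C; \<open>mat_bound_limit\<close>
  carries this bound over to the entrywise sum.\<close>

lemma norm_closure_series:
  assumes X: "\<And>S T. S \<in> X \<Longrightarrow> T \<in> X \<Longrightarrow> mat_add S T \<in> X" and zero: "mat_zero \<in> X"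
    and T: "\<And>l. T l \<in> norm_closure X" and C: "\<And>l. mat_bound (T l) (C l)" "summable C"
  shows "(\<lambda>i j. \<Sum>l. T l i j) \<in> norm_closure X"
proof (rule norm_closure_closed)
  fix e :: real assume e: "0 < e"
  obtain N where N: "\<And>m n. N \<le> m \<Longrightarrow> norm (\<Sum>l\<in>{m..<n}. C l) < e"
    using C(2) e unfolding summable_Cauchy by blast
  define P where "P n = (\<lambda>i j. \<Sum>l<n. T l i j)" for n
  have "P n \<in> norm_closure X" for n
  proof (induction n)
    case 0
    have "P 0 = mat_zero" by (simp add: P_def mat_zero_def)
    then show ?case
      using norm_closure_superset[OF zero] mat_bound_zero by (auto simp: bounded_op_iff)
  next
    case (Suc n)
    have "P (Suc n) = mat_add (P n) (T n)" by (simp add: P_def mat_add_def)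
    then show ?case using norm_closure_add[OF X Suc T[of n]] by simp
  qed
  moreover have "mat_bound (mat_diff (\<lambda>i j. \<Sum>l. T l i j) (P N)) e"
  proof (rule mat_bound_limit)
    show "(\<lambda>n. mat_diff (P n) (P N) i j) \<longlonglongrightarrow> mat_diff (\<lambda>i j. \<Sum>l. T l i j) (P N) i j" for i j
      unfolding mat_diff_def P_def
      by (intro tendsto_intros summable_LIMSEQ mat_series_summable[OF C])
    show "eventually (\<lambda>n. mat_bound (mat_diff (P n) (P N)) e) sequentially"
      using eventually_ge_at_top[of N]
    proof eventually_elim
      case (elim n)
      have "mat_diff (P n) (P N) = (\<lambda>i j. \<Sum>l\<in>{N..<n}. T l i j)"
        using elim by (simp add: mat_diff_def P_def lessThan_atLeast0 sum_diff_nat_ivl)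
      moreover have "(\<Sum>l\<in>{N..<n}. C l) \<le> e" using N[of N n] by simp
      ultimately show ?case
        using mat_bound_mono[OF mat_bound_sum[of "{N..<n}" T C, OF C(1)]] by simp
    qed
  qed
  ultimately show "\<exists>T'\<in>norm_closure X. mat_bound (mat_diff (\<lambda>i j. \<Sum>l. T l i j) T') e"
    by blast
qed

section \<open>Diagonal, shift and banded matrices\<close>

definition diag :: "('i \<Rightarrow> complex) \<Rightarrow> 'i mat" where
  "diag u = (\<lambda>i j. if i = j then u i else 0)"

lemma infsum_single:
  fixes f :: "'a \<Rightarrow> complex"
  assumes "\<And>k. k \<noteq> a \<Longrightarrow> f k = 0"
  shows "infsum f UNIV = f a"
proof -
  have "infsum f UNIV = infsum f {a}"
    by (rule infsum_cong_neutral) (use assms in auto)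
  then show ?thesis by simp
qed

lemma mat_mult_diag_left: "mat_mult (diag u) T = (\<lambda>i j. u i * T i j)"
proof (intro ext)
  fix i j
  show "mat_mult (diag u) T i j = u i * T i j"
    unfolding mat_mult_def by (subst infsum_single[of i]) (auto simp: diag_def)
qed

lemma mat_mult_diag_right: "mat_mult T (diag u) = (\<lambda>i j. T i j * u j)"
proof (intro ext)
  fix i j
  show "mat_mult T (diag u) i j = T i j * u j"
    unfolding mat_mult_def by (subst infsum_single[of j]) (auto simp: diag_def)
qed

lemma mat_adj_diag: "mat_adj (diag u) = diag (\<lambda>i. cnj (u i))"
  by (intro ext) (simp add: mat_adj_def diag_def)

lemma mat_mult_Ushift_right: "mat_mult T Ushift = (\<lambda>i j. T i (Suc j))"
proof (intro ext)
  fix i j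
  show "mat_mult T Ushift i j = T i (Suc j)"
    unfolding mat_mult_def by (subst infsum_single[of "Suc j"]) (auto simp: Ushift_def)
qed

lemma mat_mult_Ushift_left: "mat_mult Ushift T = (\<lambda>i j. case i of 0 \<Rightarrow> 0 | Suc k \<Rightarrow> T k j)"
proof (intro ext)
  fix i j
  show "mat_mult Ushift T i j = (case i of 0 \<Rightarrow> 0 | Suc k \<Rightarrow> T k j)"
    unfolding mat_mult_def by (subst infsum_single[of "i - 1"]) (auto simp: Ushift_def split: nat.split)
qed

lemma mat_mult_adj_Ushift_left: "mat_mult (mat_adj Ushift) T = (\<lambda>i j. T (Suc i) j)"
proof (intro ext)
  fix i j
  show "mat_mult (mat_adj Ushift) T i j = T (Suc i) j"
    unfolding mat_mult_def by (subst infsum_single[of "Suc i"]) (auto simp: Ushift_def mat_adj_def)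
qed

lemma mat_mult_adj_Ushift_right:
  "mat_mult T (mat_adj Ushift) = (\<lambda>i j. case j of 0 \<Rightarrow> 0 | Suc k \<Rightarrow> T i k)"
proof (intro ext)
  fix i j
  show "mat_mult T (mat_adj Ushift) i j = (case j of 0 \<Rightarrow> 0 | Suc k \<Rightarrow> T i k)"
    unfolding mat_mult_def
    by (subst infsum_single[of "j - 1"]) (auto simp: Ushift_def mat_adj_def split: nat.split)
qed

lemma mat_mult_Vshift_right: "mat_mult T Vshift = (\<lambda>i j. T i (j + 1))"
proof (intro ext)
  fix i j
  show "mat_mult T Vshift i j = T i (j + 1)"
    unfolding mat_mult_def by (subst infsum_single[of "j + 1"]) (auto simp: Vshift_def)
qed

lemma mat_mult_Vshift_left: "mat_mult Vshift T = (\<lambda>i j. T (i - 1) j)"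
proof (intro ext)
  fix i j
  show "mat_mult Vshift T i j = T (i - 1) j"
    unfolding mat_mult_def by (subst infsum_single[of "i - 1"]) (auto simp: Vshift_def)
qed

lemma mat_mult_Vshift_inv_right: "mat_mult T Vshift_inv = (\<lambda>i j. T i (j - 1))"
proof (intro ext)
  fix i j
  show "mat_mult T Vshift_inv i j = T i (j - 1)"
    unfolding mat_mult_def by (subst infsum_single[of "j - 1"]) (auto simp: Vshift_inv_def)
qed

lemma mat_mult_Vshift_inv_left: "mat_mult Vshift_inv T = (\<lambda>i j. T (i + 1) j)"
proof (intro ext)
  fix i j
  show "mat_mult Vshift_inv T i j = T (i + 1) j"
    unfolding mat_mult_def by (subst infsum_single[of "i + 1"]) (auto simp: Vshift_inv_def)
qed

lemma mat_adj_Vshift: "mat_adj Vshift = Vshift_inv"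
  by (intro ext) (simp add: mat_adj_def Vshift_def Vshift_inv_def)

lemma L2_set_subset: "finite B \<Longrightarrow> A \<subseteq> B \<Longrightarrow> L2_set f A \<le> L2_set f B"
  unfolding L2_set_def by (intro real_sqrt_le_mono sum_mono2) auto

text \<open>Injectivity of f allows y to be reindexed along f without increasing its norm. Applied
  with f = \<open>Suc\<close> to the shift and with f = \<open>id\<close> to diagonal
  matrices.\<close>

lemma mat_bound_partial_isometry:
  assumes "inj f"
  shows "mat_bound (\<lambda>i j. if i = f j then 1 else 0) 1"
proof (rule mat_boundI)
  fix I J :: "'a set" and x y :: "'a \<Rightarrow> complex"
  assume fin: "finite I" "finite J"
  define J' where "J' = {j \<in> J. f j \<in> I}"
  have J': "finite J'" "J' \<subseteq> J" using fin by (auto simp: J'_def)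
  have "(\<Sum>i\<in>I. \<Sum>j\<in>J. y i * (if i = f j then 1 else 0) * x j)
      = (\<Sum>j\<in>J. \<Sum>i\<in>I. if i = f j then y i * x j else 0)"
    by (subst sum.swap) (auto intro!: sum.cong)
  also have "\<dots> = (\<Sum>j\<in>J. if f j \<in> I then y (f j) * x j else 0)"
    by (simp add: fin sum.delta)
  also have "\<dots> = (\<Sum>j\<in>J'. y (f j) * x j)"
    using fin by (simp add: J'_def sum.inter_filter)
  also have "cmod \<dots> \<le> (\<Sum>j\<in>J'. \<bar>cmod (y (f j))\<bar> * \<bar>cmod (x j)\<bar>)"
    by (rule order_trans[OF norm_sum]) (simp add: norm_mult)
  also have "\<dots> \<le> L2_set (\<lambda>j. cmod (y (f j))) J' * L2_set (\<lambda>j. cmod (x j)) J'"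
    by (rule L2_set_mult_ineq)
  also have "L2_set (\<lambda>j. cmod (y (f j))) J' = L2_set (\<lambda>i. cmod (y i)) (f ` J')"
    using assms by (simp add: L2_set_def sum.reindex inj_on_def)
  also have "L2_set (\<lambda>i. cmod (y i)) (f ` J') * L2_set (\<lambda>j. cmod (x j)) J'
      \<le> L2_set (\<lambda>i. cmod (y i)) I * L2_set (\<lambda>j. cmod (x j)) J"
    using fin J' by (intro mult_mono L2_set_subset) (auto simp: J'_def)
  finally show "cmod (\<Sum>i\<in>I. \<Sum>j\<in>J. y i * (if i = f j then 1 else 0) * x j)
      \<le> 1 * L2_set (\<lambda>i. cmod (y i)) I * L2_set (\<lambda>j. cmod (x j)) J"
    by simp
qed simp

lemma mat_bound_Ushift: "mat_bound Ushift 1"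
  unfolding Ushift_def by (rule mat_bound_partial_isometry) simp

lemma mat_bound_diag_mat:
  assumes "\<And>i. cmod (u i) \<le> a"
  shows "mat_bound (diag u) a"
proof -
  have "0 \<le> a" using assms norm_ge_zero order_trans by blast
  then have "mat_bound (\<lambda>i j. u i * (if i = id j then 1 else 0) * 1) (a * 1 * 1)"
    by (intro mat_bound_diag mat_bound_partial_isometry assms) auto
  moreover have "diag u = (\<lambda>i j. u i * (if i = id j then 1 else 0) * 1)"
    by (intro ext) (simp add: diag_def)
  ultimately show ?thesis by simp
qed

section \<open>Banded matrices, whose products with arbitrary matrices are finite sums\<close>

definition banded :: "nat mat \<Rightarrow> bool" where
  "banded a \<longleftrightarrow> (\<exists>r. \<forall>i j. a i j \<noteq> 0 \<longrightarrow> i \<le> j + r \<and> j \<le> i + r)"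

lemma bandedE:
  assumes "banded a"
  obtains r where "\<And>i j. a i j \<noteq> 0 \<Longrightarrow> i \<le> j + r \<and> j \<le> i + r"
  using assms unfolding banded_def by blast

lemma banded_finite_row:
  assumes "banded a"
  shows "finite {j. a i j \<noteq> 0}"
proof -
  obtain r where r: "\<And>i j. a i j \<noteq> 0 \<Longrightarrow> i \<le> j + r \<and> j \<le> i + r"
    by (rule bandedE[OF assms]) blast
  have "{j. a i j \<noteq> 0} \<subseteq> {..i + r}" using r by auto
  then show ?thesis by (rule finite_subset) simp
qed

lemma banded_finite_col:
  assumes "banded a"
  shows "finite {i. a i j \<noteq> 0}"
proof -
  obtain r where r: "\<And>i j. a i j \<noteq> 0 \<Longrightarrow> i \<le> j + r \<and> j \<le> i + r"
    by (rule bandedE[OF assms]) blast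
  have "{i. a i j \<noteq> 0} \<subseteq> {..j + r}" using r by auto
  then show ?thesis by (rule finite_subset) simp
qed

lemma mat_mult_nonzeroE:
  assumes "mat_mult S T i j \<noteq> 0"
  obtains k where "S i k \<noteq> 0" "T k j \<noteq> 0"
proof -
  have "\<exists>k. S i k * T k j \<noteq> 0"
    using assms infsum_0[of UNIV "\<lambda>k. S i k * T k j"] by (auto simp: mat_mult_def)
  then show ?thesis using that by auto
qed

lemma banded_add:
  assumes "banded a" "banded b"
  shows "banded (mat_add a b)"
proof -
  obtain r where r: "\<And>i j. a i j \<noteq> 0 \<Longrightarrow> i \<le> j + r \<and> j \<le> i + r"
    by (rule bandedE[OF assms(1)]) blast
  obtain s where s: "\<And>i j. b i j \<noteq> 0 \<Longrightarrow> i \<le> j + s \<and> j \<le> i + s"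
    by (rule bandedE[OF assms(2)]) blast
  have "i \<le> j + (r + s) \<and> j \<le> i + (r + s)" if "mat_add a b i j \<noteq> 0" for i j
  proof -
    have "a i j \<noteq> 0 \<or> b i j \<noteq> 0" using that by (auto simp: mat_add_def)
    then show ?thesis using r[of i j] s[of i j] by auto
  qed
  then show ?thesis unfolding banded_def by blast
qed

lemma banded_scale: "banded a \<Longrightarrow> banded (mat_scale c a)"
  unfolding banded_def mat_scale_def by auto

lemma banded_adj: "banded a \<Longrightarrow> banded (mat_adj a)"
  unfolding banded_def mat_adj_def by fastforce

lemma banded_mult:
  assumes "banded a" "banded b"
  shows "banded (mat_mult a b)"
proof -
  obtain r where r: "\<And>i j. a i j \<noteq> 0 \<Longrightarrow> i \<le> j + r \<and> j \<le> i + r"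
    by (rule bandedE[OF assms(1)]) blast
  obtain s where s: "\<And>i j. b i j \<noteq> 0 \<Longrightarrow> i \<le> j + s \<and> j \<le> i + s"
    by (rule bandedE[OF assms(2)]) blast
  have "i \<le> j + (r + s) \<and> j \<le> i + (r + s)" if nz: "mat_mult a b i j \<noteq> 0" for i j
  proof -
    obtain k where "a i k \<noteq> 0" "b k j \<noteq> 0" using nz by (rule mat_mult_nonzeroE)
    then show ?thesis using r[of i k] s[of k j] by auto
  qed
  then show ?thesis unfolding banded_def by blast
qed

lemma banded_diag: "banded (diag u)"
  unfolding banded_def diag_def by auto

lemma banded_Ushift: "banded Ushift"
  unfolding banded_def Ushift_def by (intro exI[of _ 1]) auto

lemma star_alg_banded:
  assumes "\<And>T. T \<in> S \<Longrightarrow> banded T" "T \<in> star_alg S"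
  shows "banded T"
  using assms(2)
  by (induction rule: star_alg.induct) (auto intro: assms(1) banded_add banded_scale banded_mult banded_adj)

lemma finite_support_summable:
  fixes f :: "'a \<Rightarrow> complex"
  shows "finite {k. f k \<noteq> 0} \<Longrightarrow> f summable_on UNIV"
  by (rule finite_nonzero_values_imp_summable_on) simp

text \<open>Associativity is an interchange of two infinite sums and can fail for unbounded
  matrices; finite support of the double family makes the interchange harmless.\<close>

lemma mat_mult_assoc_finite:
  assumes "\<And>i j. finite {(m, k). R i m \<noteq> 0 \<and> S m k \<noteq> 0 \<and> T k j \<noteq> 0}"
  shows "mat_mult (mat_mult R S) T = mat_mult R (mat_mult S T)"
proof (intro ext)
  fix i j
  have "finite (prod.swap ` {(m, k). R i m \<noteq> 0 \<and> S m k \<noteq> 0 \<and> T k j \<noteq> 0})"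
    by (rule finite_imageI[OF assms])
  then have "finite {p \<in> UNIV \<times> UNIV. (case p of (k, m) \<Rightarrow> R i m * S m k * T k j) \<noteq> 0}"
    by (rule finite_subset[rotated]) force
  then have sum: "(\<lambda>(k, m). R i m * S m k * T k j) summable_on UNIV \<times> UNIV"
    by (rule finite_nonzero_values_imp_summable_on)
  have "mat_mult (mat_mult R S) T i j = infsum (\<lambda>k. infsum (\<lambda>m. R i m * S m k * T k j) UNIV) UNIV"
    unfolding mat_mult_def by (simp add: infsum_cmult_left')
  also have "\<dots> = infsum (\<lambda>m. infsum (\<lambda>k. R i m * S m k * T k j) UNIV) UNIV"
    by (rule infsum_swap_banach[OF sum])
  also have "\<dots> = mat_mult R (mat_mult S T) i j"
    unfolding mat_mult_def by (simp add: infsum_cmult_right' mult.assoc)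
  finally show "mat_mult (mat_mult R S) T i j = mat_mult R (mat_mult S T) i j" .
qed

text \<open>Any two banded factors suffice. All three positions of the unrestricted factor occur in
  \<open>commut_mult\<close>.\<close>

lemma banded_assoc_RS:
  assumes "banded R" "banded S"
  shows "mat_mult (mat_mult R S) T = mat_mult R (mat_mult S T)"
proof (rule mat_mult_assoc_finite)
  fix i j
  have "{(m, k). R i m \<noteq> 0 \<and> S m k \<noteq> 0 \<and> T k j \<noteq> 0} \<subseteq> Sigma {m. R i m \<noteq> 0} (\<lambda>m. {k. S m k \<noteq> 0})"
    by auto
  then show "finite {(m, k). R i m \<noteq> 0 \<and> S m k \<noteq> 0 \<and> T k j \<noteq> 0}"
    using assms by (elim finite_subset) (intro finite_SigmaI banded_finite_row)
qed

lemma banded_assoc_ST: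
  assumes "banded S" "banded T"
  shows "mat_mult (mat_mult R S) T = mat_mult R (mat_mult S T)"
proof (rule mat_mult_assoc_finite)
  fix i j
  have "{(m, k). R i m \<noteq> 0 \<and> S m k \<noteq> 0 \<and> T k j \<noteq> 0}
      \<subseteq> prod.swap ` Sigma {k. T k j \<noteq> 0} (\<lambda>k. {m. S m k \<noteq> 0})"
    by force
  then show "finite {(m, k). R i m \<noteq> 0 \<and> S m k \<noteq> 0 \<and> T k j \<noteq> 0}"
    using assms by (elim finite_subset) (intro finite_imageI finite_SigmaI banded_finite_col)
qed

lemma banded_assoc_RT:
  assumes "banded R" "banded T"
  shows "mat_mult (mat_mult R S) T = mat_mult R (mat_mult S T)"
proof (rule mat_mult_assoc_finite)
  fix i j
  have "{(m, k). R i m \<noteq> 0 \<and> S m k \<noteq> 0 \<and> T k j \<noteq> 0} \<subseteq> {m. R i m \<noteq> 0} \<times> {k. T k j \<noteq> 0}"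
    by auto
  then show "finite {(m, k). R i m \<noteq> 0 \<and> S m k \<noteq> 0 \<and> T k j \<noteq> 0}"
    using assms by (elim finite_subset) (intro finite_cartesian_product banded_finite_row banded_finite_col)
qed

lemma banded_summable_left: "banded a \<Longrightarrow> (\<lambda>k. a i k * T k j) summable_on UNIV"
  by (rule finite_support_summable, rule finite_subset[OF _ banded_finite_row[of a i]]) auto

lemma banded_summable_right: "banded a \<Longrightarrow> (\<lambda>k. T i k * a k j) summable_on UNIV"
  by (rule finite_support_summable, rule finite_subset[OF _ banded_finite_col[of a j]]) auto

lemma infsum_diff':
  fixes f g :: "'a \<Rightarrow> complex"
  assumes "f summable_on A" "g summable_on A"
  shows "infsum (\<lambda>x. f x - g x) A = infsum f A - infsum g A"
  using infsum_add[OF assms(1), of "\<lambda>x. - g x"] assms(2) by (simp add: infsum_uminus summable_on_uminus)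

section \<open>Commutators with an arbitrary infinite matrix\<close>

definition commut :: "nat mat \<Rightarrow> nat mat \<Rightarrow> nat mat" where
  "commut \<alpha> a = mat_diff (mat_mult \<alpha> a) (mat_mult a \<alpha>)"

lemma commut_add:
  assumes "banded a" "banded b"
  shows "commut \<alpha> (mat_add a b) = mat_add (commut \<alpha> a) (commut \<alpha> b)"
  using assms
  by (simp add: commut_def mat_add_def mat_diff_def mat_mult_def distrib_left distrib_right
      infsum_add banded_summable_left banded_summable_right add_diff_add)

lemma commut_scale: "commut \<alpha> (mat_scale c a) = mat_scale c (commut \<alpha> a)"
proof -
  have "mat_mult \<alpha> (mat_scale c a) = mat_scale c (mat_mult \<alpha> a)"
    by (simp add: mat_mult_def mat_scale_def mult.left_commute infsum_cmult_right')
  moreover have "mat_mult (mat_scale c a) \<alpha> = mat_scale c (mat_mult a \<alpha>)"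
    by (simp add: mat_mult_def mat_scale_def mult.assoc infsum_cmult_right')
  ultimately show ?thesis
    by (simp add: commut_def mat_diff_scale)
qed

text \<open>The two triple products with \<alpha> in the middle cancel by
  \<open>banded_assoc_RT\<close>; \<alpha> may be unbounded.\<close>

lemma commut_mult:
  assumes a: "banded a" and b: "banded b"
  shows "commut \<alpha> (mat_mult a b) = mat_add (mat_mult a (commut \<alpha> b)) (mat_mult (commut \<alpha> a) b)"
proof -
  have 1: "mat_mult a (commut \<alpha> b) = mat_diff (mat_mult a (mat_mult \<alpha> b)) (mat_mult a (mat_mult b \<alpha>))"
    unfolding commut_def mat_diff_def mat_mult_def[of a]
    using a by (simp add: right_diff_distrib infsum_diff' banded_summable_left)
  have 2: "mat_mult (commut \<alpha> a) b = mat_diff (mat_mult (mat_mult \<alpha> a) b) (mat_mult (mat_mult a \<alpha>) b)"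
    unfolding commut_def mat_diff_def mat_mult_def[of _ b]
    using b by (simp add: left_diff_distrib infsum_diff' banded_summable_right)
  show ?thesis
    unfolding 1 2 banded_assoc_ST[OF a b] banded_assoc_RT[OF a b]
    unfolding commut_def banded_assoc_RS[OF a b]
    by (simp add: mat_diff_def mat_add_def)
qed

lemma commut_diag: "commut \<alpha> (diag u) = (\<lambda>i j. \<alpha> i j * (u j - u i))"
  by (simp add: commut_def mat_mult_diag_left mat_mult_diag_right mat_diff_def algebra_simps)

lemma commut_Ushift: "commut \<alpha> Ushift = (\<lambda>i j. \<alpha> i (Suc j) - (case i of 0 \<Rightarrow> 0 | Suc k \<Rightarrow> \<alpha> k j))"
  by (simp add: commut_def mat_mult_Ushift_left mat_mult_Ushift_right mat_diff_def)

section \<open>Characters of a totally disconnected compact group\<close>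

text \<open>The circle has no small subgroups. This forces a character to be trivial on a
  neighbourhood of 0 in \<open>character_finite_order\<close>.\<close>

lemma unit_power_near_one_imp_one:
  fixes z :: complex
  assumes "cmod z = 1" and near: "\<And>n::nat. cmod (z ^ n - 1) < 1"
  shows "z = 1"
proof (rule ccontr)
  assume "z \<noteq> 1"
  define t where "t n = cmod (z ^ (2 ^ n) - 1)" for n
  \<comment> \<open>Squaring expands the distance to 1, since |w + 1|^2 = 4 - |w - 1|^2 > 3 on the unit circle.\<close>
  have step: "t (Suc n) \<ge> (3/2) * t n" for n
  proof -
    define w where "w = z ^ (2 ^ n)"
    have w: "cmod w = 1" by (simp add: w_def norm_power assms(1))
    have "z ^ (2 ^ Suc n) = w * w"
      by (simp add: w_def mult_2 power_add)
    then have "z ^ (2 ^ Suc n) - 1 = (w - 1) * (w + 1)"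
      by (simp add: algebra_simps)
    then have eq: "t (Suc n) = t n * cmod (w + 1)"
      by (simp add: t_def w_def norm_mult)
    have "(cmod (w + 1))\<^sup>2 + (cmod (w - 1))\<^sup>2 = 4"
    proof -
      have "(Re w)\<^sup>2 + (Im w)\<^sup>2 = 1" using w cmod_power2[of w] by simp
      then show ?thesis unfolding cmod_power2 by (simp add: power2_eq_square algebra_simps)
    qed
    moreover have "(cmod (w - 1))\<^sup>2 < 1"
      using near[of "2 ^ n"] by (simp add: w_def abs_square_less_1)
    ultimately have "(3/2)\<^sup>2 \<le> (cmod (w + 1))\<^sup>2" by (simp add: power2_eq_square)
    then have "3/2 \<le> cmod (w + 1)" by (rule power2_le_imp_le) simp
    then show ?thesis
      using eq mult_left_mono[of "3/2" "cmod (w + 1)" "t n"] by (simp add: t_def mult.commute)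
  qed
  have "t n \<ge> (3/2) ^ n * t 0" for n
  proof (induction n)
    case (Suc n)
    then show ?case using step[of n] by simp
  qed simp
  moreover have pos: "0 < t 0" using \<open>z \<noteq> 1\<close> by (simp add: t_def)
  obtain n where "1 / t 0 < (3/2 :: real) ^ n"
    using real_arch_pow[of "3/2" "1 / t 0"] by auto
  then have "1 < (3/2) ^ n * t 0" using pos by (simp add: field_simps)
  moreover have "t n < 1" unfolding t_def by (rule near)
  ultimately show False by (meson less_le_trans not_less_iff_gr_or_eq order_less_trans)
qed

text \<open>In a compact Hausdorff space components agree with quasi-components, so a point that is
  its own component can be split off from a disjoint closed set by a clopen set.\<close>

lemma clopen_neighbourhood:
  fixes a :: "'a::t2_space"
  assumes "compact (UNIV :: 'a set)" "totally_disconnected_space TYPE('a)"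
    and W: "open W" "a \<in> W"
  obtains C where "open C" "closed C" "a \<in> C" "C \<subseteq> W"
proof -
  have "separated_between euclidean {a} (- W)"
  proof (rule cut_wire_fence_theorem_gen)
    show "compact_space (euclidean :: 'a topology)"
      using assms(1) by (simp add: compact_space_def)
    show "Hausdorff_space (euclidean :: 'a topology) \<or> regular_space (euclidean :: 'a topology)
        \<or> normal_space (euclidean :: 'a topology)"
    proof -
      have "Hausdorff_space (euclidean :: 'a topology)"
        unfolding Hausdorff_space_def disjnt_def by (metis hausdorff open_openin)
      then show ?thesis ..
    qed
    show "closedin euclidean (- W)" using W(1) by (simp add: closed_Compl)
    fix C :: "'a set" assume "connectedin euclidean C"
    then obtain b where "C \<subseteq> {b}"
      using assms(2) by (auto simp: totally_disconnected_space_def)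
    then show "disjnt C {a} \<or> disjnt C (- W)"
      using W(2) by (auto simp: disjnt_def)
  qed simp
  then obtain U V where UV: "open U" "open V" "U \<union> V = UNIV" "disjnt U V" "a \<in> U" "- W \<subseteq> V"
    by (auto simp: separated_between_def)
  then have "U = - V" by (auto simp: disjnt_def)
  then have "closed U" using UV(2) by (simp add: closed_Compl)
  with UV \<open>U = - V\<close> that[of U] show ?thesis by auto
qed

text \<open>A tube-lemma argument over the compact set C. If 0 lies in C, adding v repeatedly keeps
  all multiples of v in C; this stands in for the open subgroup of van Dantzig's theorem.\<close>

lemma clopen_translation_stable:
  fixes C :: "'a::{topological_ab_group_add,t2_space} set"
  assumes "compact (UNIV :: 'a set)" "open C" "closed C"
  obtains V where "open V" "0 \<in> V" "\<And>c v. c \<in> C \<Longrightarrow> v \<in> V \<Longrightarrow> c + v \<in> C"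
proof -
  have "\<forall>c\<in>C. \<exists>p. open (fst p) \<and> open (snd p) \<and> c \<in> fst p \<and> 0 \<in> snd p
      \<and> (\<forall>x\<in>fst p. \<forall>y\<in>snd p. x + y \<in> C)"
  proof
    fix c assume c: "c \<in> C"
    have "eventually (\<lambda>p. fst p + snd p \<in> C) (nhds c \<times>\<^sub>F nhds (0::'a))"
      using c by (intro topological_tendstoD[OF tendsto_add_Pair assms(2)]) auto
    then obtain P Q where PQ: "eventually P (nhds c)" "eventually Q (nhds (0::'a))"
      "\<And>x y. P x \<Longrightarrow> Q y \<Longrightarrow> x + y \<in> C"
      by (auto simp: eventually_prod_filter)
    obtain A where "open A" "c \<in> A" "\<forall>x\<in>A. P x"
      using PQ(1) by (auto simp: eventually_nhds)
    moreover obtain B where "open B" "0 \<in> B" "\<forall>x\<in>B. Q x"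
      using PQ(2) by (auto simp: eventually_nhds)
    ultimately show "\<exists>p. open (fst p) \<and> open (snd p) \<and> c \<in> fst p \<and> 0 \<in> snd p
        \<and> (\<forall>x\<in>fst p. \<forall>y\<in>snd p. x + y \<in> C)"
      using PQ(3) by (intro exI[of _ "(A, B)"]) auto
  qed
  from bchoice[OF this] obtain f where f: "\<And>c. c \<in> C \<Longrightarrow> open (fst (f c)) \<and> open (snd (f c))
      \<and> c \<in> fst (f c) \<and> 0 \<in> snd (f c) \<and> (\<forall>x\<in>fst (f c). \<forall>y\<in>snd (f c). x + y \<in> C)"
    by blast
  define A B where "A c = fst (f c)" and "B c = snd (f c)" for c
  have AB: "\<And>c. c \<in> C \<Longrightarrow> open (A c) \<and> open (B c) \<and> c \<in> A c \<and> 0 \<in> B c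
      \<and> (\<forall>x\<in>A c. \<forall>y\<in>B c. x + y \<in> C)"
    using f unfolding A_def B_def by blast
  have "compact C" using compact_Int_closed[OF assms(1,3)] by simp
  then obtain D where D: "D \<subseteq> C" "finite D" "C \<subseteq> (\<Union>c\<in>D. A c)"
    by (rule compactE_image[of C C A]) (use AB in auto)
  show ?thesis
  proof (rule that[of "\<Inter>c\<in>D. B c"])
    show "open (\<Inter>c\<in>D. B c)" using D AB by (intro open_INT) auto
    show "0 \<in> (\<Inter>c\<in>D. B c)" using D AB by auto
    fix c v assume "c \<in> C" "v \<in> (\<Inter>c\<in>D. B c)"
    then show "c + v \<in> C" using D AB by blast
  qed
qed

lemma character_zero: "character ch \<Longrightarrow> ch 0 = 1"
proof -
  assume "character ch"
  then have "ch 0 = ch 0 * ch 0" "cmod (ch 0) = 1"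
    by (metis add_0 character_def, simp add: character_def)
  then show ?thesis by (metis mult_cancel_right1 norm_zero zero_neq_one)
qed

lemma character_multiple: "character ch \<Longrightarrow> ch (\<Sum>_\<in>{..<n}. x) = ch x ^ n" for n :: nat
proof (induction n)
  case 0
  then show ?case by (simp add: character_zero)
next
  case (Suc n)
  have "(\<Sum>_\<in>{..<Suc n}. x) = (\<Sum>_\<in>{..<n}. x) + x"
    by (rule sum.lessThan_Suc)
  moreover have "ch ((\<Sum>_\<in>{..<n}. x) + x) = ch (\<Sum>_\<in>{..<n}. x) * ch x"
    using Suc.prems unfolding character_def by blast
  ultimately show ?case using Suc by (simp only: power_Suc2)
qed

lemma character_orb:
  assumes "character ch"
  shows "ch (orb x n) = ch x powi n"
proof (cases "0 \<le> n")
  case True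
  then show ?thesis
    unfolding orb_def zmul_def using character_multiple[OF assms, of x "nat n"]
    by (simp add: power_int_def del: sum_constant)
next
  case False
  define y where "y = (\<Sum>_\<in>{..<nat (- n)}. x)"
  have "ch (- y) * ch y = ch (- y + y)"
    using assms unfolding character_def by metis
  then have "ch (- y) = inverse (ch y)"
    using character_zero[OF assms] by (metis add.left_inverse inverse_unique mult.commute)
  moreover have "ch y = ch x ^ nat (- n)"
    unfolding y_def by (rule character_multiple[OF assms])
  ultimately show ?thesis
    unfolding orb_def zmul_def using False
    by (simp add: power_int_def power_inverse flip: y_def del: sum_constant)
qed

text \<open>\<open>ch\<close> is 1 on a neighbourhood V of 0, because the multiples of an element of
  V stay in a clopen set on which \<open>ch\<close> is close to 1. Finitely many translates of V
  cover the group, so \<open>ch\<close> has finite range and two powers of \<open>ch x\<close>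
  coincide.\<close>

lemma character_finite_order:
  fixes x :: "'a::{topological_ab_group_add,t2_space}"
  assumes comp: "compact (UNIV :: 'a set)" and td: "totally_disconnected_space TYPE('a)"
    and ch: "character ch"
  obtains n :: nat where "0 < n" "ch x ^ n = 1"
proof -
  define W where "W = ch -` ball 1 1"
  have "open W"
    unfolding W_def using ch by (intro open_vimage) (auto simp: character_def)
  moreover have "0 \<in> W" using character_zero[OF ch] by (simp add: W_def)
  ultimately obtain C where C: "open C" "closed C" "0 \<in> C" "C \<subseteq> W"
    by (rule clopen_neighbourhood[OF comp td])
  obtain V where V: "open V" "0 \<in> V" "\<And>c v. c \<in> C \<Longrightarrow> v \<in> V \<Longrightarrow> c + v \<in> C"
    by (rule clopen_translation_stable[OF comp C(1,2)]) blast
  have one: "ch v = 1" if v: "v \<in> V" for v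
  proof (rule unit_power_near_one_imp_one)
    show "cmod (ch v) = 1" using ch by (simp add: character_def)
    fix n :: nat
    have "(\<Sum>_\<in>{..<n}. v) \<in> C"
    proof (induction n)
      case (Suc n)
      have "(\<Sum>_\<in>{..<Suc n}. v) = (\<Sum>_\<in>{..<n}. v) + v"
        by (rule sum.lessThan_Suc)
      then show ?case using V(3)[OF Suc v] by (simp only:)
    qed (simp add: C)
    then have "ch (\<Sum>_\<in>{..<n}. v) \<in> ball 1 1" using C(4) by (auto simp: W_def)
    then show "cmod (ch v ^ n - 1) < 1"
      unfolding character_multiple[OF ch] by (simp add: dist_norm norm_minus_commute)
  qed
  obtain D where D: "finite D" "UNIV \<subseteq> (\<Union>g\<in>D. (\<lambda>y. y - g) -` V)"
  proof (rule compactE_image[OF comp, of UNIV "\<lambda>g. (\<lambda>y. y - g) -` V"])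
    show "open ((\<lambda>y. y - g) -` V)" for g
      by (intro open_vimage V continuous_intros)
    show "UNIV \<subseteq> (\<Union>g. (\<lambda>y. y - g) -` V)" using V(2) by auto
  qed (use that in blast)
  have fin: "range ch \<subseteq> ch ` D"
  proof safe
    fix y
    obtain g where g: "g \<in> D" "y - g \<in> V" using D by auto
    have "ch y = ch (y - g) * ch g"
      using ch unfolding character_def by (metis diff_add_cancel)
    then show "ch y \<in> ch ` D" using one[OF g(2)] g(1) by simp
  qed
  have "finite (range (\<lambda>n::nat. ch x ^ n))"
  proof (rule finite_subset)
    show "range (\<lambda>n::nat. ch x ^ n) \<subseteq> ch ` D"
      using fin unfolding character_multiple[OF ch, of x, symmetric] by blast
  qed (use D in simp)
  then have "\<not> inj (\<lambda>n::nat. ch x ^ n)"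
    using finite_imageD infinite_UNIV_nat by blast
  then obtain m n :: nat where mn: "m < n" "ch x ^ m = ch x ^ n"
    unfolding inj_def by (metis linorder_neqE_nat)
  have "ch x \<noteq> 0" using ch by (metis character_def norm_zero zero_neq_one)
  moreover have "ch x ^ n = ch x ^ m * ch x ^ (n - m)"
    using mn(1) by (simp flip: power_add)
  ultimately have "ch x ^ (n - m) = 1" using mn(2) by simp
  then show ?thesis using mn(1) that[of "n - m"] by simp
qed

section \<open>The dual group and averaging\<close>

text \<open>Projection onto selected diagonals. For X a translate of \<open>S n\<close> it is a
  spectral projection of the action of \<open>F n\<close> by conjugation with the matrices
  diag(z^i); see \<open>band_cut_average\<close>.\<close>

definition band_cut :: "int set \<Rightarrow> nat mat \<Rightarrow> nat mat" where
  "band_cut X a = (\<lambda>i j. if int i - int j \<in> X then a i j else 0)"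

locale derivation_lifting =
  fixes x1 :: "'g::{topological_ab_group_add, t2_space}"
    and \<pi> :: "nat mat \<Rightarrow> int mat"
    and \<delta> :: "int mat \<Rightarrow> int mat"
  assumes compact_group: "compact (UNIV :: 'g set)"
    and totally_disconnected: "totally_disconnected_space TYPE('g)"
    and symbol: "is_symbol_map x1 \<pi>"
    and derivation: "is_derivation (Balg0 x1) (Balg x1) \<delta>"
begin

abbreviation A where "A \<equiv> Aalg x1"
abbreviation B0 where "B0 \<equiv> Balg0 x1"

section \<open>The algebra \<open>A\<close> and the symbol map\<close>

lemma generators_bounded_banded:
  assumes "T \<in> {Ushift} \<union> {Mplus x1 f | f. continuous_on UNIV f}"
  shows "bounded_op T \<and> banded T"
proof (cases "T = Ushift")
  case True
  then show ?thesis using mat_bound_Ushift banded_Ushift by (auto simp: bounded_op_iff)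
next
  case False
  then obtain f where f: "T = Mplus x1 f" "continuous_on UNIV f" using assms by auto
  then have T: "T = diag (\<lambda>i. f (orb x1 (int i)))" by (auto simp: Mplus_def diag_def)
  have "bounded (range f)"
    using compact_continuous_image[OF f(2) compact_group] by (rule compact_imp_bounded)
  then obtain C where "\<And>x. cmod (f x) \<le> C" by (auto simp: bounded_iff)
  then have "mat_bound T C" unfolding T by (intro mat_bound_diag_mat)
  then show ?thesis
    using banded_diag by (auto simp: bounded_op_iff T)
qed

lemma star_alg_in_A:
  assumes "T \<in> star_alg ({Ushift} \<union> {Mplus x1 f | f. continuous_on UNIV f})"
  shows "T \<in> A"
  unfolding Aalg_def cstar_gen_def
  by (rule norm_closure_superset[OF assms], rule star_alg_bounded[OF _ assms])
    (use generators_bounded_banded in blast)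

lemma A_add: "a \<in> A \<Longrightarrow> b \<in> A \<Longrightarrow> mat_add a b \<in> A"
  unfolding Aalg_def cstar_gen_def by (rule norm_closure_add) (rule star_alg.add)

lemma A_scale: "a \<in> A \<Longrightarrow> mat_scale c a \<in> A"
  unfolding Aalg_def cstar_gen_def by (rule norm_closure_scale) (rule star_alg.scale)

lemma A_mult: "a \<in> A \<Longrightarrow> b \<in> A \<Longrightarrow> mat_mult a b \<in> A"
  unfolding Aalg_def cstar_gen_def by (rule norm_closure_mult) (rule star_alg.mult)

lemma A_adj: "a \<in> A \<Longrightarrow> mat_adj a \<in> A"
  unfolding Aalg_def cstar_gen_def by (rule norm_closure_adj) (rule star_alg.adj)

lemma A_diff: "a \<in> A \<Longrightarrow> b \<in> A \<Longrightarrow> mat_diff a b \<in> A"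
  unfolding mat_diff_conv by (intro A_add A_scale)

lemma A_bounded: "a \<in> A \<Longrightarrow> \<exists>C. mat_bound a C"
  unfolding Aalg_def cstar_gen_def by (rule norm_closure_bounded)

lemma A_closed: "(\<And>e. 0 < e \<Longrightarrow> \<exists>b\<in>A. mat_bound (mat_diff a b) e) \<Longrightarrow> a \<in> A"
  unfolding Aalg_def cstar_gen_def by (rule norm_closure_closed)

lemma A_Ushift: "Ushift \<in> A"
  by (rule star_alg_in_A) (auto intro: star_alg.gen)

lemma A_Mplus: "continuous_on UNIV f \<Longrightarrow> Mplus x1 f \<in> A"
  by (rule star_alg_in_A) (auto intro: star_alg.gen)

lemma pi_add: "a \<in> A \<Longrightarrow> b \<in> A \<Longrightarrow> \<pi> (mat_add a b) = mat_add (\<pi> a) (\<pi> b)"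
  using symbol by (simp add: is_symbol_map_def)

lemma pi_scale: "a \<in> A \<Longrightarrow> \<pi> (mat_scale c a) = mat_scale c (\<pi> a)"
  using symbol by (simp add: is_symbol_map_def)

lemma pi_mult: "a \<in> A \<Longrightarrow> b \<in> A \<Longrightarrow> \<pi> (mat_mult a b) = mat_mult (\<pi> a) (\<pi> b)"
  using symbol by (simp add: is_symbol_map_def)

lemma pi_adj: "a \<in> A \<Longrightarrow> \<pi> (mat_adj a) = mat_adj (\<pi> a)"
  using symbol by (simp add: is_symbol_map_def)

lemma pi_diff: "a \<in> A \<Longrightarrow> b \<in> A \<Longrightarrow> \<pi> (mat_diff a b) = mat_diff (\<pi> a) (\<pi> b)"
  by (simp add: mat_diff_conv pi_add pi_scale A_scale)

lemma pi_Ushift: "\<pi> Ushift = Vshift"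
  using symbol by (simp add: is_symbol_map_def)

lemma pi_Mplus: "continuous_on UNIV f \<Longrightarrow> \<pi> (Mplus x1 f) = Mfull x1 f"
  using symbol by (simp add: is_symbol_map_def)

lemma pi_onto: "b \<in> Balg x1 \<Longrightarrow> \<exists>a\<in>A. \<pi> a = b"
proof -
  assume "b \<in> Balg x1"
  moreover have "\<pi> ` A = Balg x1" using symbol by (simp add: is_symbol_map_def)
  ultimately have "b \<in> \<pi> ` A" by simp
  then show ?thesis by blast
qed

lemma compact_iff: "k \<in> compact_ops \<longleftrightarrow> k \<in> A \<and> \<pi> k = mat_zero"
  using symbol by (auto simp: is_symbol_map_def)

lemma A_zero: "mat_zero \<in> A"
  and pi_zero: "\<pi> mat_zero = mat_zero"
proof -
  have eq: "mat_zero = mat_scale 0 (T :: 'i mat)" for T :: "'i mat"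
    by (simp add: mat_zero_def mat_scale_def)
  show "mat_zero \<in> A" unfolding eq[of Ushift] by (rule A_scale[OF A_Ushift])
  show "\<pi> mat_zero = mat_zero"
    unfolding eq[of Ushift] pi_scale[OF A_Ushift] by (simp add: mat_scale_def mat_zero_def)
qed

lemma A_pi_sum:
  assumes "\<And>z. z \<in> F \<Longrightarrow> T z \<in> A"
  shows "(\<lambda>i j. \<Sum>z\<in>F. T z i j) \<in> A \<and> \<pi> (\<lambda>i j. \<Sum>z\<in>F. T z i j) = (\<lambda>i j. \<Sum>z\<in>F. \<pi> (T z) i j)"
  using assms
proof (induction F rule: infinite_finite_induct)
  case (insert z F)
  have "(\<lambda>i j. \<Sum>z\<in>insert z F. T z i j) = mat_add (T z) (\<lambda>i j. \<Sum>z\<in>F. T z i j)"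
    using insert.hyps by (simp add: mat_add_def)
  moreover have "(\<lambda>i j. \<Sum>z\<in>insert z F. \<pi> (T z) i j) = mat_add (\<pi> (T z)) (\<lambda>i j. \<Sum>z\<in>F. \<pi> (T z) i j)"
    using insert.hyps by (simp add: mat_add_def)
  ultimately show ?case using insert by (simp add: A_add pi_add)
qed (use A_zero pi_zero in \<open>auto simp: mat_zero_def\<close>)

lemmas A_sum = A_pi_sum[THEN conjunct1]
lemmas pi_sum = A_pi_sum[THEN conjunct2]

section \<open>The dual group, realised in the unit circle by evaluation at
  \<open>x1\<close>\<close>

definition Z :: "complex set" where
  "Z = {ch x1 | ch. character ch}"

lemma Mplus_character: "character ch \<Longrightarrow> Mplus x1 ch = diag (\<lambda>i. ch x1 ^ i)"
  by (intro ext) (simp add: Mplus_def diag_def character_orb)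

lemma Mfull_character: "character ch \<Longrightarrow> Mfull x1 ch = diag (\<lambda>i. ch x1 powi i)"
  by (intro ext) (simp add: Mfull_def diag_def character_orb)

lemma
  assumes "z \<in> Z"
  shows A_diag_power: "diag (\<lambda>i. z ^ i) \<in> A"
    and pi_diag_power: "\<pi> (diag (\<lambda>i. z ^ i)) = diag (\<lambda>i. z powi i)"
    and B0_diag_power: "diag (\<lambda>i. z powi i) \<in> B0"
    and Z_norm: "cmod z = 1"
    and Z_nonzero: "z \<noteq> 0"
proof -
  obtain ch where ch: "character ch" "z = ch x1" using assms by (auto simp: Z_def)
  then have cont: "continuous_on UNIV ch" by (simp add: character_def)
  show "diag (\<lambda>i. z ^ i) \<in> A"
    using A_Mplus[OF cont] Mplus_character[OF ch(1)] ch(2) by simp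
  show "\<pi> (diag (\<lambda>i. z ^ i)) = diag (\<lambda>i. z powi i)"
    using pi_Mplus[OF cont] Mplus_character[OF ch(1)] Mfull_character[OF ch(1)] ch(2) by simp
  show "diag (\<lambda>i. z powi i) \<in> B0"
    using Mfull_character[OF ch(1)] ch unfolding Balg0_def by (intro star_alg.gen) force
  show "cmod z = 1" using ch by (simp add: character_def)
  then show "z \<noteq> 0" by auto
qed

lemma Z_one: "1 \<in> Z"
proof -
  have "character (\<lambda>_::'g. 1)" by (simp add: character_def)
  then show ?thesis unfolding Z_def by force
qed

lemma Z_mult: "z \<in> Z \<Longrightarrow> w \<in> Z \<Longrightarrow> z * w \<in> Z"
proof -
  assume "z \<in> Z" "w \<in> Z"
  then obtain ch ch' where ch: "character ch" "z = ch x1" "character ch'" "w = ch' x1"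
    by (auto simp: Z_def)
  then have "character (\<lambda>x. ch x * ch' x)"
    by (auto simp: character_def norm_mult intro!: continuous_intros)
  then show ?thesis unfolding Z_def using ch by force
qed

lemma Z_inverse: "z \<in> Z \<Longrightarrow> inverse z \<in> Z"
proof -
  assume "z \<in> Z"
  then obtain ch where ch: "character ch" "z = ch x1" by (auto simp: Z_def)
  then have "ch x \<noteq> 0" for x by (metis character_def norm_zero zero_neq_one)
  then have "character (\<lambda>x. inverse (ch x))"
    using ch by (auto simp: character_def norm_inverse intro!: continuous_intros)
  then show ?thesis unfolding Z_def using ch by force
qed

text \<open>Factorials make these groups of roots of unity increase with n, and every finite order
  divides some factorial, so they exhaust \<open>Z\<close>.\<close>

definition F :: "nat \<Rightarrow> complex set" where
  "F n = {z \<in> Z. z ^ fact n = 1}"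

lemma F_sub_Z: "F n \<subseteq> Z"
  by (auto simp: F_def)

lemma F_finite: "finite (F n)"
proof -
  have "finite {z :: complex. z ^ fact n = 1}" by (rule finite_roots_unity) (simp add: fact_ge_1)
  then show ?thesis by (rule finite_subset[rotated]) (auto simp: F_def)
qed

lemma F_one: "1 \<in> F n"
  by (simp add: F_def Z_one)

lemma F_zero: "F 0 = {1}"
  using Z_one by (auto simp: F_def)

lemma F_mult: "z \<in> F n \<Longrightarrow> w \<in> F n \<Longrightarrow> z * w \<in> F n"
  by (simp add: F_def Z_mult power_mult_distrib)

lemma F_inverse: "z \<in> F n \<Longrightarrow> inverse z \<in> F n"
  by (simp add: F_def Z_inverse power_inverse)

lemma F_mono: "m \<le> n \<Longrightarrow> F m \<subseteq> F n"
proof -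
  assume "m \<le> n"
  then obtain k :: nat where k: "fact n = fact m * k"
    using fact_dvd[of m n] unfolding dvd_def by blast
  show ?thesis unfolding F_def k power_mult by auto
qed

lemma Z_eq_Union_F: "z \<in> Z \<Longrightarrow> \<exists>n. z \<in> F n"
proof -
  assume z: "z \<in> Z"
  then obtain ch where ch: "character ch" "z = ch x1" by (auto simp: Z_def)
  obtain n :: nat where n: "0 < n" "ch x1 ^ n = 1"
    by (rule character_finite_order[OF compact_group totally_disconnected ch(1)])
  then have "n dvd fact n" by (simp add: dvd_fact)
  then obtain k where "fact n = n * k" unfolding dvd_def by blast
  then have "z ^ fact n = 1" using n ch(2) by (simp add: power_mult)
  then show ?thesis using z by (auto simp: F_def)
qed

lemma F_translate: "w \<in> F n \<Longrightarrow> bij_betw ((*) w) (F n) (F n)"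
proof (rule bij_betw_byWitness[where f' = "(*) (inverse w)"])
  assume w: "w \<in> F n"
  then have "w \<noteq> 0" using Z_nonzero F_sub_Z by blast
  then show "\<forall>a\<in>F n. inverse w * (w * a) = a" "\<forall>a\<in>F n. w * (inverse w * a) = a" by auto
  show "(*) w ` F n \<subseteq> F n" "(*) (inverse w) ` F n \<subseteq> F n"
    using F_mult[OF w] F_mult[OF F_inverse[OF w]] by auto
qed

section \<open>Annihilators of the groups \<open>F n\<close> and averages over them\<close>

definition S :: "nat \<Rightarrow> int set" where
  "S n = {k. \<forall>z\<in>F n. z powi k = 1}"

definition Sinf :: "int set" where
  "Sinf = (\<Inter>n. S n)"

lemma S_antimono: "m \<le> n \<Longrightarrow> S n \<subseteq> S m"
  using F_mono unfolding S_def by blast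

lemma S_zero: "S 0 = UNIV"
  by (auto simp: S_def F_zero)

text \<open>Outside the annihilator some w has \<open>w powi k\<close> different from 1; translating
  the sum by w multiplies it by this factor, so it is 0.\<close>

lemma F_orthogonality:
  "(\<Sum>z\<in>F n. z powi k) = (if k \<in> S n then of_nat (card (F n)) else 0)"
proof (cases "k \<in> S n")
  case True
  then have "(\<Sum>z\<in>F n. z powi k) = (\<Sum>z\<in>F n. 1)" unfolding S_def by (intro sum.cong) auto
  then show ?thesis using True by simp
next
  case False
  then obtain w where w: "w \<in> F n" "w powi k \<noteq> 1" by (auto simp: S_def)
  have "(\<Sum>z\<in>F n. z powi k) = (\<Sum>z\<in>F n. (w * z) powi k)"
    by (rule sum.reindex_bij_betw[OF F_translate[OF w(1)], symmetric])
  also have "\<dots> = w powi k * (\<Sum>z\<in>F n. z powi k)"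
    by (simp add: power_int_mult_distrib sum_distrib_left)
  finally have "(\<Sum>z\<in>F n. z powi k) = 0" using w(2) by simp
  then show ?thesis using False by simp
qed

lemma card_F_pos: "0 < card (F n)"
  using F_one F_finite card_gt_0_iff by blast

text \<open>The offset is needed because V sits on diagonal 1: multiplying a matrix with diagonals
  in X by V gives one with diagonals in \<open>shifted 1 X\<close>.\<close>

definition shifted :: "int \<Rightarrow> int set \<Rightarrow> int set" where
  "shifted t X = {k. k - t \<in> X}"

lemma F_average:
  "(\<Sum>z\<in>F n. z powi (k - t) / of_nat (card (F n))) = (if k \<in> shifted t (S n) then 1 else 0)"
  using card_F_pos[of n] F_orthogonality[of "k - t" n]
  by (simp add: shifted_def flip: sum_divide_distrib)

lemma powi_nat_diff:
  "z \<noteq> 0 \<Longrightarrow> z powi (int i - int j - t) = z ^ i * inverse z ^ j * z powi (- t)" for z :: complex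
  by (simp add: power_int_diff power_int_minus divide_inverse power_inverse)

text \<open>Conjugation by diag(z^i) multiplies diagonal k by z^k, and averaging against z^(-t)
  selects k - t in \<open>S n\<close>. Membership in \<open>A\<close>, the symbol and the norm bound
  of the cut are all read off from this formula.\<close>

lemma band_cut_average:
  "band_cut (shifted t (S n)) a =
    (\<lambda>i j. \<Sum>z\<in>F n. (z powi (- t) / of_nat (card (F n))) * (z ^ i * a i j * inverse z ^ j))"
proof (intro ext)
  fix i j
  have "(\<Sum>z\<in>F n. (z powi (- t) / of_nat (card (F n))) * (z ^ i * a i j * inverse z ^ j))
      = (\<Sum>z\<in>F n. z powi (int i - int j - t) / of_nat (card (F n)) * a i j)"
  proof (rule sum.cong[OF refl])
    fix z assume "z \<in> F n"
    then have "z \<noteq> 0" using Z_nonzero F_sub_Z by blast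
    then show "(z powi (- t) / of_nat (card (F n))) * (z ^ i * a i j * inverse z ^ j)
        = z powi (int i - int j - t) / of_nat (card (F n)) * a i j"
      unfolding powi_nat_diff[OF \<open>z \<noteq> 0\<close>] by (simp add: field_simps)
  qed
  also have "\<dots> = band_cut (shifted t (S n)) a i j"
    unfolding sum_distrib_right[symmetric] F_average by (simp add: band_cut_def)
  finally show "band_cut (shifted t (S n)) a i j =
      (\<Sum>z\<in>F n. (z powi (- t) / of_nat (card (F n))) * (z ^ i * a i j * inverse z ^ j))" ..
qed

lemma
  assumes a: "a \<in> A"
  shows A_band_cut: "band_cut (shifted t (S n)) a \<in> A"
    and pi_band_cut: "\<pi> (band_cut (shifted t (S n)) a)
      = (\<lambda>i j. if i - j \<in> shifted t (S n) then \<pi> a i j else 0)"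
proof -
  define T where "T z = mat_scale (z powi (- t) / of_nat (card (F n)))
      (mat_mult (mat_mult (diag (\<lambda>i. z ^ i)) a) (diag (\<lambda>j. inverse z ^ j)))" for z :: complex
  have eq: "band_cut (shifted t (S n)) a = (\<lambda>i j. \<Sum>z\<in>F n. T z i j)"
    unfolding band_cut_average by (simp add: T_def mat_scale_def mat_mult_diag_left mat_mult_diag_right)
  have zA: "diag (\<lambda>i. z ^ i) \<in> A" "diag (\<lambda>i. inverse z ^ i) \<in> A" if "z \<in> F n" for z
    using that F_sub_Z A_diag_power Z_inverse by blast+
  have TA: "T z \<in> A" if "z \<in> F n" for z
    unfolding T_def by (intro A_scale A_mult a zA that)
  show "band_cut (shifted t (S n)) a \<in> A"
    unfolding eq by (intro A_sum TA)
  have "\<pi> (band_cut (shifted t (S n)) a) = (\<lambda>i j. \<Sum>z\<in>F n. \<pi> (T z) i j)"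
    unfolding eq by (intro pi_sum TA)
  also have "\<dots> = (\<lambda>i j. \<Sum>z\<in>F n. z powi (i - j - t) / of_nat (card (F n)) * \<pi> a i j)"
  proof (intro ext sum.cong refl)
    fix i j :: int and z assume z: "z \<in> F n"
    then have zZ: "z \<in> Z" "inverse z \<in> Z" "z \<noteq> 0" using F_sub_Z Z_inverse Z_nonzero by blast+
    have "\<pi> (T z) = mat_scale (z powi (- t) / of_nat (card (F n)))
        (mat_mult (mat_mult (diag (\<lambda>i. z powi i)) (\<pi> a)) (diag (\<lambda>j. inverse z powi j)))"
      unfolding T_def using zA[OF z] a zZ
      by (simp add: pi_scale pi_mult A_mult pi_diag_power del: power_inverse)
    then have "\<pi> (T z) i j = z powi (- t) / of_nat (card (F n)) * (z powi i * \<pi> a i j * inverse z powi j)"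
      by (simp add: mat_scale_def mat_mult_diag_left mat_mult_diag_right)
    also have "\<dots> = z powi (i - j - t) / of_nat (card (F n)) * \<pi> a i j"
      using zZ by (simp add: power_int_diff power_int_minus power_int_inverse power_int_add field_simps)
    finally show "\<pi> (T z) i j = z powi (i - j - t) / of_nat (card (F n)) * \<pi> a i j" .
  qed
  also have "\<dots> = (\<lambda>i j. if i - j \<in> shifted t (S n) then \<pi> a i j else 0)"
    unfolding sum_distrib_right[symmetric] F_average by (intro ext) simp
  finally show "\<pi> (band_cut (shifted t (S n)) a)
      = (\<lambda>i j. if i - j \<in> shifted t (S n) then \<pi> a i j else 0)" .
qed

lemma mat_bound_band_cut:
  assumes "mat_bound a C"
  shows "mat_bound (band_cut (shifted t (S n)) a) C"
proof -
  have "mat_bound (\<lambda>i j. (z powi (- t) / of_nat (card (F n))) * (z ^ i * a i j * inverse z ^ j))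
      (C / card (F n))" if "z \<in> F n" for z
  proof -
    have z: "cmod z = 1" using that F_sub_Z Z_norm by blast
    have "mat_bound (\<lambda>i j. z ^ i * a i j * inverse z ^ j) (1 * C * 1)"
      using z by (intro mat_bound_diag[OF assms]) (auto simp: norm_power norm_inverse)
    then have "mat_bound (mat_scale (z powi (- t) / of_nat (card (F n)))
        (\<lambda>i j. z ^ i * a i j * inverse z ^ j)) (cmod (z powi (- t) / of_nat (card (F n))) * C)"
      by (intro mat_bound_scale) simp
    then show ?thesis
      using z by (simp add: mat_scale_def norm_divide norm_power_int)
  qed
  then have "mat_bound (band_cut (shifted t (S n)) a) (\<Sum>z\<in>F n. C / card (F n))"
    unfolding band_cut_average by (rule mat_bound_sum)
  then show ?thesis using card_F_pos[of n] by simp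
qed

lemma eventually_S_eq_Sinf: "eventually (\<lambda>n. k \<in> S n \<longleftrightarrow> k \<in> Sinf) sequentially"
proof (cases "k \<in> Sinf")
  case True
  then show ?thesis by (simp add: Sinf_def)
next
  case False
  then obtain m where "k \<notin> S m" by (auto simp: Sinf_def)
  then have "k \<notin> S n" if "m \<le> n" for n using S_antimono[OF that] by blast
  then show ?thesis using False by (auto simp: eventually_sequentially)
qed

text \<open>The bound is inherited from the averages over \<open>F n\<close>: in each entry the cuts
  by \<open>S n\<close> are eventually equal to the cut by \<open>Sinf\<close>.\<close>

lemma mat_bound_band_cut_Sinf:
  assumes "mat_bound a C"
  shows "mat_bound (band_cut (shifted t Sinf) a) C"
proof (rule mat_bound_limit)
  show "eventually (\<lambda>n. mat_bound (band_cut (shifted t (S n)) a) C) sequentially"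
    using mat_bound_band_cut[OF assms] by simp
  fix i j
  have "eventually (\<lambda>n. band_cut (shifted t (S n)) a i j = band_cut (shifted t Sinf) a i j) sequentially"
    using eventually_S_eq_Sinf[of "int i - int j - t"]
    by eventually_elim (simp add: band_cut_def shifted_def)
  then show "(\<lambda>n. band_cut (shifted t (S n)) a i j) \<longlonglongrightarrow> band_cut (shifted t Sinf) a i j"
    by (rule tendsto_eventually)
qed

lemma banded_band_cut_eventually:
  assumes "banded a"
  shows "eventually (\<lambda>n. band_cut (shifted t (S n)) a = band_cut (shifted t Sinf) a) sequentially"
proof -
  obtain r where r: "\<And>i j. a i j \<noteq> 0 \<Longrightarrow> i \<le> j + r \<and> j \<le> i + r"
    by (rule bandedE[OF assms]) blast
  have "eventually (\<lambda>n. \<forall>k\<in>{- int r..int r}. k - t \<in> S n \<longleftrightarrow> k - t \<in> Sinf) sequentially"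
    by (intro eventually_ball_finite ballI eventually_S_eq_Sinf) simp
  then show ?thesis
  proof eventually_elim
    case (elim n)
    show ?case
    proof (intro ext)
      fix i j
      show "band_cut (shifted t (S n)) a i j = band_cut (shifted t Sinf) a i j"
      proof (cases "a i j = 0")
        case False
        then have "int i - int j \<in> {- int r..int r}" using r[of i j] by auto
        then show ?thesis using elim by (simp add: band_cut_def shifted_def)
      qed (simp add: band_cut_def)
    qed
  qed
qed

lemma band_cut_diff: "band_cut X (mat_diff a b) = mat_diff (band_cut X a) (band_cut X b)"
  by (intro ext) (simp add: band_cut_def mat_diff_def)

text \<open>On a banded b the cuts stabilise, since only finitely many diagonals occur. A general a
  is within e/2 of such a b, and the cuts are contractions.\<close>

lemma band_cut_converges:
  assumes "a \<in> A" "0 < e"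
  shows "eventually (\<lambda>n. mat_bound (mat_diff (band_cut (shifted t (S n)) a)
      (band_cut (shifted t Sinf) a)) e) sequentially"
proof -
  obtain b where b: "b \<in> star_alg ({Ushift} \<union> {Mplus x1 f | f. continuous_on UNIV f})"
    "mat_bound (mat_diff a b) (e/2)"
    using assms unfolding Aalg_def cstar_gen_def norm_closure_iff by (meson half_gt_zero)
  have "banded b"
    by (rule star_alg_banded[OF _ b(1)]) (use generators_bounded_banded in blast)
  from banded_band_cut_eventually[OF this, of t] show ?thesis
  proof eventually_elim
    case (elim n)
    have "mat_bound (mat_diff (band_cut (shifted t (S n)) (mat_diff a b))
        (band_cut (shifted t Sinf) (mat_diff a b))) (e/2 + e/2)"
      by (intro mat_bound_diff mat_bound_band_cut mat_bound_band_cut_Sinf b)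
    then show ?case
      unfolding band_cut_diff elim by (simp add: mat_diff_def)
  qed
qed

lemma A_band_cut_Sinf:
  assumes "a \<in> A"
  shows "band_cut (shifted t Sinf) a \<in> A"
proof (rule A_closed)
  fix e :: real assume "0 < e"
  from eventually_happens[OF band_cut_converges[OF assms this, of t]]
  obtain n where "mat_bound (mat_diff (band_cut (shifted t (S n)) a) (band_cut (shifted t Sinf) a)) e"
    by auto
  then show "\<exists>b\<in>A. mat_bound (mat_diff (band_cut (shifted t Sinf) a) b) e"
    using A_band_cut[OF assms] mat_bound_diff_commute by blast
qed

subsection \<open>Symbols of the implementing elements\<close>

lemma delta_in: "b \<in> B0 \<Longrightarrow> \<delta> b \<in> Balg x1"
  using derivation by (simp add: is_derivation_def)

lemma delta_add: "a \<in> B0 \<Longrightarrow> b \<in> B0 \<Longrightarrow> \<delta> (mat_add a b) = mat_add (\<delta> a) (\<delta> b)"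
  using derivation by (simp add: is_derivation_def)

lemma delta_scale: "a \<in> B0 \<Longrightarrow> \<delta> (mat_scale c a) = mat_scale c (\<delta> a)"
  using derivation by (simp add: is_derivation_def)

lemma delta_mult:
  "a \<in> B0 \<Longrightarrow> b \<in> B0 \<Longrightarrow> \<delta> (mat_mult a b) = mat_add (mat_mult a (\<delta> b)) (mat_mult (\<delta> a) b)"
  using derivation by (simp add: is_derivation_def)

lemma B0_mult: "a \<in> B0 \<Longrightarrow> b \<in> B0 \<Longrightarrow> mat_mult a b \<in> B0"
  unfolding Balg0_def by (rule star_alg.mult)

lemma B0_Vshift: "Vshift \<in> B0" and B0_Vshift_inv: "Vshift_inv \<in> B0"
  unfolding Balg0_def by (auto intro: star_alg.gen)

definition P :: "complex \<Rightarrow> int mat" where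
  "P z = \<delta> (diag (\<lambda>i. z powi i))"

definition Q :: "int mat" where
  "Q = \<delta> Vshift"

text \<open>\<delta> applied to M_(zw) = M_z M_w: P is a cocycle on the dual group.\<close>

lemma P_mult:
  assumes "z \<in> Z" "w \<in> Z"
  shows "P (z * w) i j = z powi i * P w i j + P z i j * w powi j"
proof -
  have "diag (\<lambda>i. (z * w) powi i) = mat_mult (diag (\<lambda>i. z powi i)) (diag (\<lambda>i. w powi i))"
    unfolding mat_mult_diag_left by (intro ext) (simp add: diag_def power_int_mult_distrib)
  then have "P (z * w) = mat_add (mat_mult (diag (\<lambda>i. z powi i)) (P w)) (mat_mult (P z) (diag (\<lambda>i. w powi i)))"
    unfolding P_def using delta_mult[OF B0_diag_power B0_diag_power] assms by simp
  then show ?thesis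
    by (simp add: mat_add_def mat_mult_diag_left mat_mult_diag_right)
qed

lemma P_one: "P 1 = mat_zero"
proof (intro ext)
  fix i j
  show "P 1 i j = mat_zero i j"
    using P_mult[OF Z_one Z_one, of i j] by (simp add: mat_zero_def)
qed

text \<open>\<delta> applied to the commutation relation M_z V = z V M_z.\<close>

lemma P_Vshift:
  assumes "z \<in> Z"
  shows "z powi i * Q i j + P z i (j + 1) = z * (P z (i - 1) j + Q i j * z powi j)"
proof -
  define D where "D = diag (\<lambda>i. z powi i)"
  have D: "D \<in> B0" unfolding D_def by (rule B0_diag_power[OF assms])
  have "mat_mult D Vshift = mat_scale z (mat_mult Vshift D)"
  proof (intro ext)
    fix i j :: int
    have "z powi (j + 1) = z * z powi j"
      using Z_nonzero[OF assms] by (simp add: power_int_add)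
    then show "mat_mult D Vshift i j = mat_scale z (mat_mult Vshift D) i j"
      unfolding mat_mult_Vshift_right mat_mult_Vshift_left mat_scale_def
      by (simp add: D_def diag_def)
  qed
  then have "mat_add (mat_mult D Q) (mat_mult (P z) Vshift)
      = mat_scale z (mat_add (mat_mult Vshift (P z)) (mat_mult Q D))"
    using delta_mult[OF D B0_Vshift] delta_mult[OF B0_Vshift D]
      delta_scale[OF B0_mult[OF B0_Vshift D], of z]
    unfolding Q_def P_def D_def[symmetric] by simp
  then have "mat_add (mat_mult D Q) (mat_mult (P z) Vshift) i j
      = mat_scale z (mat_add (mat_mult Vshift (P z)) (mat_mult Q D)) i j"
    by simp
  then show ?thesis
    unfolding mat_mult_Vshift_right mat_mult_Vshift_left mat_scale_def mat_add_def D_def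
      mat_mult_diag_left mat_mult_diag_right .
qed

text \<open>Averaging over the finite group F n makes the derivation inner on the span of the M_w with
  w in F n: the implementing element is the mean of P z M_z^(-1).\<close>

definition impl_symbol :: "nat \<Rightarrow> int mat" where
  "impl_symbol n = (\<lambda>i j. \<Sum>z\<in>F n. P z i j * z powi (- j) / of_nat (card (F n)))"

text \<open>A cocycle on a finite group is a coboundary: substitute w z for z in the mean and expand
  by \<open>P_mult\<close>. The factor \<open>w powi j - w powi i\<close> is the effect of commuting
  with M_w on entry (i, j).\<close>

lemma impl_symbol_diag:
  assumes w: "w \<in> F n"
  shows "impl_symbol n i j * (w powi j - w powi i) = P w i j"
proof -
  have wZ: "w \<in> Z" "w \<noteq> 0" using w F_sub_Z Z_nonzero by blast+
  define N where "N = (of_nat (card (F n)) :: complex)"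
  have N: "N \<noteq> 0" using card_F_pos[of n] by (simp add: N_def)
  have "impl_symbol n i j = (\<Sum>z\<in>F n. P (w * z) i j * (w * z) powi (- j) / N)"
    unfolding impl_symbol_def N_def
    by (rule sum.reindex_bij_betw[OF F_translate[OF w], symmetric])
  also have "\<dots> = (\<Sum>z\<in>F n. w powi (- j) * (w powi i * (P z i j * z powi (- j) / N) + P w i j / N))"
  proof (rule sum.cong[OF refl])
    fix z assume "z \<in> F n"
    then have z: "z \<in> Z" "z \<noteq> 0" using F_sub_Z Z_nonzero by blast+
    have "z powi j * z powi (- j) = 1" using z by (simp add: power_int_minus)
    then have "P w i j * z powi j * z powi (- j) = P w i j" by (simp add: mult.assoc)
    then show "P (w * z) i j * (w * z) powi (- j) / N
        = w powi (- j) * (w powi i * (P z i j * z powi (- j) / N) + P w i j / N)"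
      unfolding P_mult[OF wZ(1) z(1)] power_int_mult_distrib
      by (simp add: algebra_simps add_divide_distrib)
  qed
  also have "\<dots> = w powi (- j) * (w powi i * impl_symbol n i j + P w i j)"
    unfolding sum_distrib_left[symmetric] sum.distrib impl_symbol_def N_def[symmetric]
    using N by (simp add: N_def)
  finally have "w powi j * impl_symbol n i j
      = w powi j * (w powi (- j) * (w powi i * impl_symbol n i j + P w i j))"
    by simp
  also have "\<dots> = w powi i * impl_symbol n i j + P w i j"
    using wZ(2) by (simp add: power_int_minus)
  finally show ?thesis by (simp add: algebra_simps)
qed

text \<open>The left side is the entry of the commutator with V. \<open>P_Vshift\<close> leaves the
  coefficient z^(i-j-1) in front of Q, whose mean over \<open>F n\<close> is an indicator by
  \<open>F_average\<close>.\<close>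

lemma impl_symbol_Vshift:
  "impl_symbol n i (j + 1) - impl_symbol n (i - 1) j
    = Q i j - (if i - j \<in> shifted 1 (S n) then Q i j else 0)"
proof -
  define N where "N = (of_nat (card (F n)) :: complex)"
  have N: "N \<noteq> 0" using card_F_pos[of n] by (simp add: N_def)
  have "impl_symbol n i (j + 1)
      = (\<Sum>z\<in>F n. P z (i - 1) j * z powi (- j) / N + (Q i j / N - z powi (i - j - 1) / N * Q i j))"
    unfolding impl_symbol_def N_def[symmetric]
  proof (rule sum.cong[OF refl])
    fix z assume "z \<in> F n"
    then have z: "z \<in> Z" "z \<noteq> 0" using F_sub_Z Z_nonzero by blast+
    have "P z i (j + 1) = z * (P z (i - 1) j + Q i j * z powi j) - z powi i * Q i j"
      using P_Vshift[OF z(1), of i j] by (simp add: algebra_simps)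
    then have "P z i (j + 1) * z powi (- (j + 1))
        = P z (i - 1) j * z powi (- j) + (Q i j - z powi (i - j - 1) * Q i j)"
      using z(2) by (simp add: power_int_minus power_int_add power_int_diff field_simps)
    then show "P z i (j + 1) * z powi (- (j + 1)) / N
        = P z (i - 1) j * z powi (- j) / N + (Q i j / N - z powi (i - j - 1) / N * Q i j)"
      by (simp add: add_divide_distrib diff_divide_distrib)
  qed
  also have "\<dots> = (\<Sum>z\<in>F n. P z (i - 1) j * z powi (- j) / N)
      + ((\<Sum>z\<in>F n. Q i j / N) - (\<Sum>z\<in>F n. z powi (i - j - 1) / N) * Q i j)"
    by (simp only: sum.distrib sum_subtractf sum_distrib_right)
  also have "(\<Sum>z\<in>F n. z powi (i - j - 1) / N) = (if i - j \<in> shifted 1 (S n) then 1 else 0)"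
    unfolding N_def by (rule F_average)
  also have "(\<Sum>z\<in>F n. Q i j / N) = Q i j"
    using N by (simp add: N_def)
  also have "(\<Sum>z\<in>F n. P z (i - 1) j * z powi (- j) / N) = impl_symbol n (i - 1) j"
    by (simp add: impl_symbol_def N_def)
  finally have "impl_symbol n i (j + 1) = impl_symbol n (i - 1) j + (Q i j - (if i - j \<in> shifted 1 (S n) then 1 else 0) * Q i j)" .
  then show ?thesis by simp
qed

lemma impl_symbol_zero: "impl_symbol 0 = mat_zero"
  by (intro ext) (simp add: impl_symbol_def F_zero P_one mat_zero_def)

text \<open>Both matrices implement \<delta> on \<open>F m\<close>, so their difference commutes
  with M_w for w in \<open>F m\<close> and vanishes on every diagonal where some such w is not
  constant.\<close>

lemma impl_symbol_diff_support:
  assumes "m \<le> n" "i - j \<notin> S m"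
  shows "impl_symbol n i j = impl_symbol m i j"
proof -
  obtain w where w: "w \<in> F m" "w powi (i - j) \<noteq> 1" using assms(2) by (auto simp: S_def)
  then have w0: "w \<noteq> 0" using F_sub_Z Z_nonzero by blast
  have "w powi j - w powi i \<noteq> 0" using w(2) w0 by (auto simp: power_int_diff)
  moreover have "impl_symbol n i j * (w powi j - w powi i) = impl_symbol m i j * (w powi j - w powi i)"
    using impl_symbol_diag[OF w(1)] impl_symbol_diag[of w n] F_mono[OF assms(1)] w(1) by auto
  ultimately show ?thesis by simp
qed

section \<open>Lifts of the implementing elements to \<open>A\<close>\<close>

definition p :: "complex \<Rightarrow> nat mat" where
  "p z = (SOME a. a \<in> A \<and> \<pi> a = P z)"

definition q :: "nat mat" where
  "q = (SOME a. a \<in> A \<and> \<pi> a = Q)"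

lemma p: "z \<in> Z \<Longrightarrow> p z \<in> A \<and> \<pi> (p z) = P z"
proof -
  assume "z \<in> Z"
  then have "\<exists>a. a \<in> A \<and> \<pi> a = P z"
    using pi_onto[OF delta_in[OF B0_diag_power]] by (auto simp: P_def)
  then show ?thesis unfolding p_def by (rule someI_ex)
qed

lemma q: "q \<in> A" "\<pi> q = Q"
proof -
  have "\<exists>a. a \<in> A \<and> \<pi> a = Q"
    using pi_onto[OF delta_in[OF B0_Vshift]] by (auto simp: Q_def)
  then have "q \<in> A \<and> \<pi> q = Q"
    unfolding q_def by (rule someI_ex)
  then show "q \<in> A" "\<pi> q = Q" by auto
qed

text \<open>The mean of \<open>impl_symbol\<close> formed with chosen lifts. The lifts
  \<open>p z\<close> need not form a cocycle, so the relations of \<open>impl_symbol\<close> carry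
  over only modulo compact operators.\<close>

definition impl :: "nat \<Rightarrow> nat mat" where
  "impl n = (\<lambda>i j. \<Sum>z\<in>F n. mat_scale (1 / of_nat (card (F n)))
      (mat_mult (p z) (diag (\<lambda>j. inverse z ^ j))) i j)"

lemma A_impl: "impl n \<in> A" and pi_impl: "\<pi> (impl n) = impl_symbol n"
proof -
  have in_A: "p z \<in> A" "diag (\<lambda>i. inverse z ^ i) \<in> A" if "z \<in> F n" for z
    using that F_sub_Z p A_diag_power Z_inverse by blast+
  show "impl n \<in> A" unfolding impl_def by (intro A_sum A_scale A_mult in_A)
  have "\<pi> (impl n) = (\<lambda>i j. \<Sum>z\<in>F n. \<pi> (mat_scale (1 / of_nat (card (F n)))
      (mat_mult (p z) (diag (\<lambda>j. inverse z ^ j)))) i j)"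
    unfolding impl_def by (intro pi_sum A_scale A_mult in_A)
  also have "\<dots> = impl_symbol n"
    unfolding impl_symbol_def
  proof (intro ext sum.cong refl)
    fix i j :: int and z assume z: "z \<in> F n"
    then have zZ: "z \<in> Z" "inverse z \<in> Z" using F_sub_Z Z_inverse by blast+
    have "\<pi> (mat_scale (1 / of_nat (card (F n))) (mat_mult (p z) (diag (\<lambda>j. inverse z ^ j))))
        = mat_scale (1 / of_nat (card (F n))) (mat_mult (P z) (diag (\<lambda>j. inverse z powi j)))"
      using in_A[OF z] zZ p[OF zZ(1)]
      by (simp add: pi_scale pi_mult A_mult pi_diag_power del: power_inverse)
    then show "\<pi> (mat_scale (1 / of_nat (card (F n))) (mat_mult (p z) (diag (\<lambda>j. inverse z ^ j)))) i j
        = P z i j * z powi (- j) / of_nat (card (F n))"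
      by (simp add: mat_scale_def mat_mult_diag_right power_int_minus power_int_inverse)
  qed
  finally show "\<pi> (impl n) = impl_symbol n" .
qed

definition q_cut :: "nat \<Rightarrow> nat mat" where
  "q_cut n = band_cut (shifted 1 (S n)) q"

definition q_inf :: "nat mat" where
  "q_inf = band_cut (shifted 1 Sinf) q"

lemma q_cut_zero: "q_cut 0 = q"
  by (simp add: q_cut_def band_cut_def shifted_def S_zero)

lemma A_q_cut: "q_cut n \<in> A" and pi_q_cut: "\<pi> (q_cut n) = (\<lambda>i j. if i - j \<in> shifted 1 (S n) then Q i j else 0)"
  unfolding q_cut_def by (rule A_band_cut[OF q(1)], rule pi_band_cut[OF q(1), unfolded q(2)])

lemma A_q_inf: "q_inf \<in> A"
  unfolding q_inf_def by (rule A_band_cut_Sinf[OF q(1)])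

text \<open>Passing to a subsequence of the groups F n makes the telescoping series of the q_cut
  absolutely convergent.\<close>

lemma level_exists:
  "\<exists>h::nat \<Rightarrow> nat. h 0 = 0 \<and> mono h \<and> (\<forall>l. l \<le> h l) \<and>
     (\<exists>C. \<forall>l. mat_bound (mat_diff (q_cut (h l)) q_inf) (C * (1/2) ^ l))"
proof -
  have "\<exists>N. \<forall>n\<ge>N. mat_bound (mat_diff (q_cut n) q_inf) ((1/2) ^ l)" for l :: nat
    using band_cut_converges[OF q(1), of "(1/2) ^ l" 1]
    by (simp add: q_cut_def q_inf_def eventually_sequentially)
  then obtain N where N: "\<And>l n. N l \<le> n \<Longrightarrow> mat_bound (mat_diff (q_cut n) q_inf) ((1/2) ^ l)"
    by metis
  obtain C where C: "mat_bound (mat_diff (q_cut 0) q_inf) C"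
    using A_bounded[OF A_diff[OF A_q_cut A_q_inf]] by blast
  define h where "h l = (if l = 0 then 0 else l + (\<Sum>i\<le>l. N i))" for l
  have ge: "N l \<le> h l" if "l \<noteq> 0" for l
    using member_le_sum[of l "{..l}" N] that by (simp add: h_def)
  have "mono h"
  proof (rule monoI)
    fix l m :: nat assume "l \<le> m"
    then have "(\<Sum>i\<le>l. N i) \<le> (\<Sum>i\<le>m. N i)" by (intro sum_mono2) auto
    then show "h l \<le> h m" using \<open>l \<le> m\<close> by (auto simp: h_def)
  qed
  moreover have "mat_bound (mat_diff (q_cut (h l)) q_inf) (max 1 C * (1/2) ^ l)" for l
  proof (cases "l = 0")
    case True
    then show ?thesis using mat_bound_mono[OF C, of "max 1 C"] by (simp add: h_def)
  next
    case False
    have "1 * (1/2) ^ l \<le> max 1 C * (1/2 :: real) ^ l" by (intro mult_right_mono) auto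
    then show ?thesis using mat_bound_mono[OF N[OF ge[OF False]]] by simp
  qed
  moreover have "h 0 = 0" "\<forall>l. l \<le> h l" by (auto simp: h_def)
  ultimately show ?thesis by blast
qed

definition level :: "nat \<Rightarrow> nat" where
  "level = (SOME h. h 0 = 0 \<and> mono h \<and> (\<forall>l. l \<le> h l) \<and>
     (\<exists>C. \<forall>l. mat_bound (mat_diff (q_cut (h l)) q_inf) (C * (1/2) ^ l)))"

lemma level:
  "level 0 = 0" "mono level" "l \<le> level l"
  "\<exists>C. \<forall>l. mat_bound (mat_diff (q_cut (level l)) q_inf) (C * (1/2) ^ l)"
  using someI_ex[OF level_exists, folded level_def] by auto

text \<open>The cut restores exact commutation with diag(z^i) for z in \<open>F (level l)\<close>,
  which a lift has only modulo compacts. It does not change the symbol, by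
  \<open>impl_symbol_diff_support\<close>.\<close>

definition incr :: "nat \<Rightarrow> nat mat" where
  "incr l = band_cut (S (level l)) (mat_diff (impl (level (Suc l))) (impl (level l)))"

text \<open>The desired value of \<open>commut (incr l) Ushift\<close>, attained modulo compacts.
  These values decay geometrically and telescope to \<open>q - q_inf\<close>.\<close>

definition jump :: "nat \<Rightarrow> nat mat" where
  "jump l = mat_diff (q_cut (level l)) (q_cut (level (Suc l)))"

lemma S_shifted_0: "shifted 0 X = X"
  by (simp add: shifted_def)

lemma A_incr: "incr l \<in> A"
  and pi_incr: "\<pi> (incr l) = mat_diff (impl_symbol (level (Suc l))) (impl_symbol (level l))"
proof -
  let ?d = "mat_diff (impl (level (Suc l))) (impl (level l))"
  have d: "?d \<in> A" by (intro A_diff A_impl)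
  show "incr l \<in> A"
    using A_band_cut[OF d, of 0] by (simp add: incr_def S_shifted_0)
  have "\<pi> (incr l) = (\<lambda>i j. if i - j \<in> S (level l) then \<pi> ?d i j else 0)"
    using pi_band_cut[OF d, of 0] by (simp add: incr_def S_shifted_0)
  also have "\<pi> ?d = mat_diff (impl_symbol (level (Suc l))) (impl_symbol (level l))"
    by (simp add: pi_diff A_impl pi_impl)
  also have "(\<lambda>i j. if i - j \<in> S (level l) then
      mat_diff (impl_symbol (level (Suc l))) (impl_symbol (level l)) i j else 0)
      = mat_diff (impl_symbol (level (Suc l))) (impl_symbol (level l))"
    using impl_symbol_diff_support[OF monoD[OF level(2), of l "Suc l"]]
    by (intro ext) (simp add: mat_diff_def)
  finally show "\<pi> (incr l) = mat_diff (impl_symbol (level (Suc l))) (impl_symbol (level l))" .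
qed

lemma incr_support: "incr l i j \<noteq> 0 \<Longrightarrow> int i - int j \<in> S (level l)"
  by (simp add: incr_def band_cut_def split: if_splits)

lemma A_commut: "a \<in> A \<Longrightarrow> b \<in> A \<Longrightarrow> commut a b \<in> A"
  unfolding commut_def by (intro A_diff A_mult)

lemma pi_commut_Ushift: "a \<in> A \<Longrightarrow> \<pi> (commut a Ushift) = (\<lambda>i j. \<pi> a i (j + 1) - \<pi> a (i - 1) j)"
  unfolding commut_def
  by (simp add: pi_diff pi_mult A_mult A_Ushift pi_Ushift mat_mult_Vshift_left mat_mult_Vshift_right)
    (simp add: mat_diff_def)

lemma A_jump: "jump l \<in> A"
  unfolding jump_def by (intro A_diff A_q_cut)

lemma pi_commut_incr: "\<pi> (commut (incr l) Ushift) = \<pi> (jump l)"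
proof (intro ext)
  fix i j
  have "\<pi> (commut (incr l) Ushift) i j = (impl_symbol (level (Suc l)) i (j + 1) - impl_symbol (level (Suc l)) (i - 1) j)
      - (impl_symbol (level l) i (j + 1) - impl_symbol (level l) (i - 1) j)"
    unfolding pi_commut_Ushift[OF A_incr] pi_incr mat_diff_def by simp
  also have "\<dots> = mat_diff (\<pi> (q_cut (level l))) (\<pi> (q_cut (level (Suc l)))) i j"
    unfolding impl_symbol_Vshift pi_q_cut mat_diff_def by simp
  also have "mat_diff (\<pi> (q_cut (level l))) (\<pi> (q_cut (level (Suc l)))) = \<pi> (jump l)"
    unfolding jump_def by (rule pi_diff[OF A_q_cut A_q_cut, symmetric])
  finally show "\<pi> (commut (incr l) Ushift) i j = \<pi> (jump l) i j" .
qed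

lemma jump_bound: "\<exists>C. \<forall>l. mat_bound (jump l) (C * (1/2) ^ l)"
proof -
  obtain C where C: "\<And>l. mat_bound (mat_diff (q_cut (level l)) q_inf) (C * (1/2) ^ l)"
    using level(4) by blast
  have C0: "0 \<le> C" using mat_bound_nonneg[OF C[of 0]] by simp
  have "mat_bound (jump l) (2 * C * (1/2) ^ l)" for l
  proof -
    have "mat_bound (jump l) (C * (1/2) ^ l + C * (1/2) ^ Suc l)"
      unfolding jump_def by (rule mat_bound_diff_trans[OF C mat_bound_diff_commute[OF C]])
    moreover have "C * (1/2) ^ l + C * (1/2) ^ Suc l \<le> 2 * C * (1/2) ^ l"
      using C0 by simp
    ultimately show ?thesis by (rule mat_bound_mono)
  qed
  then show ?thesis by blast
qed

end

section \<open>The lifted derivation\<close>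

text \<open>Weights on both sides clear initial columns as well as initial rows; the columns are
  needed for \<open>alpha_column_zero\<close>.\<close>

definition sandwich :: "(nat \<Rightarrow> real) \<Rightarrow> nat mat \<Rightarrow> nat mat" where
  "sandwich w a = (\<lambda>i j. of_real (w i) * a i j * of_real (w j))"

lemma mat_bound_sandwich:
  assumes "mat_bound a C" "\<And>i. 0 \<le> w i \<and> w i \<le> 1"
  shows "mat_bound (sandwich w a) C"
  using mat_bound_diag[OF assms(1), of 1 1 "\<lambda>i. of_real (w i)" "\<lambda>i. of_real (w i)"] assms(2)
  by (simp add: sandwich_def)

text \<open>The weight vanishes on the support of a finite approximant of k and then grows linearly, with
  small slope, to 1.\<close>

lemma slow_weight:
  assumes a: "mat_bound a C" and k: "k \<in> compact_ops" and e: "0 < e"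
  obtains w :: "nat \<Rightarrow> real" where "\<And>i. 0 \<le> w i \<and> w i \<le> 1" "\<And>i. i \<le> m \<Longrightarrow> w i = 0"
    "finite {i. w i \<noteq> 1}" "mat_bound (sandwich w k) e"
    "mat_bound (mat_diff (commut (sandwich w a) Ushift) (sandwich w (commut a Ushift))) e"
proof -
  obtain k' where k': "finite {(i, j). k' i j \<noteq> 0}" "mat_bound (mat_diff k k') e"
    using k e unfolding compact_ops_def norm_closure_iff by blast
  have "finite (fst ` {(i, j). k' i j \<noteq> 0})" using k'(1) by (rule finite_imageI)
  then obtain n0 where n0: "\<forall>i\<in>fst ` {(i, j). k' i j \<noteq> 0}. i \<le> n0"
    using finite_nat_set_iff_bounded_le by blast
  define n where "n = max n0 m"
  have kn: "k' i j = 0" if "n < i" for i j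
  proof (rule ccontr)
    assume "k' i j \<noteq> 0"
    then have "i \<in> fst ` {(i, j). k' i j \<noteq> 0}" by force
    then show False using n0 that by (auto simp: n_def)
  qed
  have C: "0 \<le> C" by (rule mat_bound_nonneg[OF a])
  \<comment> \<open>The slope of the weight. Moving w past U costs at most C r on each side, and the
    two costs together must stay below e.\<close>
  define r where "r = e / (2 * (C + 1))"
  have r: "0 < r" "C * r \<le> e / 2" using e C by (auto simp: r_def field_simps)
  define w where "w i = max 0 (min 1 (r * (real i - real n)))" for i
  have w01: "0 \<le> w i \<and> w i \<le> 1" for i by (simp add: w_def)
  have w0: "w i = 0" if "i \<le> n" for i
  proof -
    have "r * (real i - real n) \<le> 0" using that r(1) by (intro mult_nonneg_nonpos) auto
    then show ?thesis by (simp add: w_def)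
  qed
  have wdiff: "\<bar>w (Suc i) - w i\<bar> \<le> r" for i
  proof -
    have "r * (real (Suc i) - real n) = r * (real i - real n) + r" by (simp add: algebra_simps)
    then show ?thesis using r(1) unfolding w_def by (auto simp: max_def min_def)
  qed
  have fin: "finite {i. w i \<noteq> 1}"
  proof -
    have "{i. w i \<noteq> 1} \<subseteq> {..n + nat \<lceil>1 / r\<rceil>}"
    proof (rule subsetI, rule ccontr)
      fix i assume i: "i \<in> {i. w i \<noteq> 1}" "i \<notin> {..n + nat \<lceil>1 / r\<rceil>}"
      then have "real n + 1 / r \<le> real i" by (simp add: not_le) linarith
      then have "1 \<le> r * (real i - real n)" using r(1) by (simp add: field_simps)
      then show False using i(1) by (simp add: w_def)
    qed
    then show ?thesis by (rule finite_subset) simp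
  qed
  have sk: "mat_bound (sandwich w k) e"
  proof -
    have "sandwich w k = sandwich w (mat_diff k k')"
    proof (intro ext)
      fix i j
      show "sandwich w k i j = sandwich w (mat_diff k k') i j"
        using w0[of i] kn[of i j] by (cases "i \<le> n") (auto simp: sandwich_def mat_diff_def)
    qed
    then show ?thesis using mat_bound_sandwich[OF k'(2) w01] by simp
  qed
  \<comment> \<open>Increments of w that arise from moving the weights past U. Truncated subtraction
    gives u 0 = 0, in accordance with the zero row 0 of U a.\<close>
  define u where "u i = complex_of_real (w i - w (i - 1))" for i
  define v where "v j = complex_of_real (w (Suc j) - w j)" for j
  have u: "cmod (u i) \<le> r" for i
    using wdiff[of "i - 1"] r(1) unfolding u_def norm_of_real by (cases i) auto
  have v: "cmod (v j) \<le> r" for j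
    using wdiff[of j] unfolding v_def norm_of_real by simp
  have "mat_diff (commut (sandwich w a) Ushift) (sandwich w (commut a Ushift))
      = mat_add (\<lambda>i j. of_real (w i) * mat_mult a Ushift i j * v j)
          (\<lambda>i j. u i * mat_mult Ushift a i j * of_real (w j))"
  proof (intro ext)
    fix i j
    show "mat_diff (commut (sandwich w a) Ushift) (sandwich w (commut a Ushift)) i j
      = mat_add (\<lambda>i j. of_real (w i) * mat_mult a Ushift i j * v j)
          (\<lambda>i j. u i * mat_mult Ushift a i j * of_real (w j)) i j"
      unfolding commut_Ushift mat_mult_Ushift_left mat_mult_Ushift_right
      by (cases i) (simp_all add: mat_diff_def mat_add_def sandwich_def u_def v_def w0 algebra_simps)
  qed
  moreover have "mat_bound \<dots> (1 * (C * 1) * r + r * (1 * C) * 1)"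
    using w01 u v r(1)
    by (intro mat_bound_add mat_bound_diag mat_bound_mult a mat_bound_Ushift) auto
  ultimately have "mat_bound (mat_diff (commut (sandwich w a) Ushift) (sandwich w (commut a Ushift))) e"
    using mat_bound_mono r(2) by (simp add: mult.commute)
  with w01 _ fin sk show ?thesis
    by (rule that) (auto intro: w0 simp: n_def)
qed

section \<open>Weighted increments and their compact defects\<close>

context derivation_lifting begin

text \<open>1 - diag w has finite rank, so it is compact and killed by \<pi>. Hence weighting by w
  keeps elements in \<open>A\<close> and does not change symbols.\<close>

lemma A_diag_weight: "finite {i. w i \<noteq> 1} \<Longrightarrow> diag w \<in> A"
  and pi_diag_weight: "finite {i. w i \<noteq> 1} \<Longrightarrow> \<pi> (diag w) = diag (\<lambda>_. 1)"
proof -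
  assume fin: "finite {i. w i \<noteq> (1 :: complex)}"
  define k where "k = diag (\<lambda>i. 1 - w i)"
  have "finite ((\<lambda>i. cmod (1 - w i)) ` {i. w i \<noteq> 1})" using fin by (rule finite_imageI)
  then obtain M where "\<forall>x\<in>(\<lambda>i. cmod (1 - w i)) ` {i. w i \<noteq> 1}. x \<le> M"
    using bdd_above_finite unfolding bdd_above_def by blast
  then have "cmod (1 - w i) \<le> max 0 M" for i by (cases "w i = 1") auto
  then have "mat_bound k (max 0 M)" unfolding k_def by (rule mat_bound_diag_mat)
  then have bdd: "bounded_op k" by (auto simp: bounded_op_iff)
  have "{(i, j). k i j \<noteq> 0} \<subseteq> (\<lambda>i. (i, i)) ` {i. w i \<noteq> 1}" by (auto simp: k_def diag_def)
  then have "finite {(i, j). k i j \<noteq> 0}" using fin by (meson finite_imageI finite_subset)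
  then have "k \<in> compact_ops"
    unfolding compact_ops_def using bdd by (intro norm_closure_superset) auto
  then have k: "k \<in> A" "\<pi> k = mat_zero" by (auto simp: compact_iff)
  have one: "diag (\<lambda>_. 1) \<in> A" "\<pi> (diag (\<lambda>_. 1)) = diag (\<lambda>_. 1)"
    using A_diag_power[OF Z_one] pi_diag_power[OF Z_one] by simp_all
  have eq: "diag w = mat_diff (diag (\<lambda>_. 1)) k"
    by (intro ext) (simp add: k_def diag_def mat_diff_def)
  show "diag w \<in> A" unfolding eq by (intro A_diff one k)
  show "\<pi> (diag w) = diag (\<lambda>_. 1)"
    unfolding eq pi_diff[OF one(1) k(1)] k(2) one(2) by (simp add: mat_diff_def mat_zero_def)
qed

lemma
  assumes "a \<in> A" "finite {i. w i \<noteq> 1}"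
  shows A_sandwich: "sandwich w a \<in> A" and pi_sandwich: "\<pi> (sandwich w a) = \<pi> a"
proof -
  have fin: "finite {i. complex_of_real (w i) \<noteq> 1}" using assms(2) by simp
  have eq: "sandwich w a = mat_mult (mat_mult (diag (\<lambda>i. of_real (w i))) a) (diag (\<lambda>i. of_real (w i)))"
    unfolding mat_mult_diag_left mat_mult_diag_right by (simp add: sandwich_def)
  note D = A_diag_weight[OF fin] pi_diag_weight[OF fin]
  show "sandwich w a \<in> A" unfolding eq by (intro A_mult D assms(1))
  have "\<pi> (sandwich w a) = mat_mult (mat_mult (diag (\<lambda>_. 1)) (\<pi> a)) (diag (\<lambda>_. 1))"
    unfolding eq pi_mult[OF A_mult[OF D(1) assms(1)] D(1)] pi_mult[OF D(1) assms(1)] D(2) ..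
  then show "\<pi> (sandwich w a) = \<pi> a"
    by (simp add: mat_mult_diag_left mat_mult_diag_right)
qed

lemma residue_compact: "mat_diff (commut (incr l) Ushift) (jump l) \<in> compact_ops"
  using A_commut[OF A_incr A_Ushift] A_jump
  by (simp add: compact_iff A_diff pi_diff pi_commut_incr) (simp add: mat_diff_def mat_zero_def)

lemma weight_exists:
  "\<exists>w. (\<forall>i. 0 \<le> w i \<and> w i \<le> 1) \<and> (\<forall>i\<le>l. w i = 0) \<and> finite {i. w i \<noteq> 1} \<and>
    mat_bound (sandwich w (mat_diff (commut (incr l) Ushift) (jump l))) ((1/2) ^ l) \<and>
    mat_bound (mat_diff (commut (sandwich w (incr l)) Ushift) (sandwich w (commut (incr l) Ushift))) ((1/2) ^ l)"
proof -
  obtain C where C: "mat_bound (incr l) C" using A_bounded[OF A_incr] by blast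
  show ?thesis
    by (rule slow_weight[OF C residue_compact[of l], of "(1/2) ^ l" l]) (simp, blast)
qed

definition wt :: "nat \<Rightarrow> nat \<Rightarrow> real" where
  "wt l = (SOME w. (\<forall>i. 0 \<le> w i \<and> w i \<le> 1) \<and> (\<forall>i\<le>l. w i = 0) \<and> finite {i. w i \<noteq> 1} \<and>
    mat_bound (sandwich w (mat_diff (commut (incr l) Ushift) (jump l))) ((1/2) ^ l) \<and>
    mat_bound (mat_diff (commut (sandwich w (incr l)) Ushift) (sandwich w (commut (incr l) Ushift))) ((1/2) ^ l))"

lemma wt:
  "0 \<le> wt l i \<and> wt l i \<le> 1" "i \<le> l \<Longrightarrow> wt l i = 0" "finite {i. wt l i \<noteq> 1}"
  "mat_bound (sandwich (wt l) (mat_diff (commut (incr l) Ushift) (jump l))) ((1/2) ^ l)"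
  "mat_bound (mat_diff (commut (sandwich (wt l) (incr l)) Ushift)
      (sandwich (wt l) (commut (incr l) Ushift))) ((1/2) ^ l)"
  using someI_ex[OF weight_exists[of l], folded wt_def] by auto

definition w_incr :: "nat \<Rightarrow> nat mat" where
  "w_incr l = sandwich (wt l) (incr l)"

text \<open>The error of the weighted increment against \<open>jump l\<close>. It is compact and
  geometrically small, so the sum over l is compact and invisible to \<pi>.\<close>

definition defect :: "nat \<Rightarrow> nat mat" where
  "defect l = mat_diff (commut (w_incr l) Ushift) (jump l)"

lemma A_w_incr: "w_incr l \<in> A" and pi_w_incr: "\<pi> (w_incr l) = \<pi> (incr l)"
  unfolding w_incr_def by (rule A_sandwich[OF A_incr wt(3)], rule pi_sandwich[OF A_incr wt(3)])

lemma w_incr_support: "w_incr l i j \<noteq> 0 \<Longrightarrow> int i - int j \<in> S (level l)"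
  using incr_support[of l i j] by (auto simp: w_incr_def sandwich_def)

lemma w_incr_initial: "i \<le> l \<or> j \<le> l \<Longrightarrow> w_incr l i j = 0"
  using wt(2)[of i l] wt(2)[of j l] by (auto simp: w_incr_def sandwich_def)

lemma defect_compact: "defect l \<in> compact_ops"
proof -
  have "\<pi> (commut (w_incr l) Ushift) = \<pi> (jump l)"
    using pi_commut_incr[of l] by (simp add: pi_commut_Ushift A_w_incr A_incr pi_w_incr)
  then show ?thesis
    using A_commut[OF A_w_incr A_Ushift] A_jump unfolding defect_def
    by (simp add: compact_iff A_diff pi_diff) (simp add: mat_diff_def mat_zero_def)
qed

text \<open>Three contributions: the slope of the weight, the weighted compact residue, and the
  weight acting on the already small \<open>jump l\<close>.\<close>

lemma defect_bound: "\<exists>C. \<forall>l. mat_bound (defect l) (C * (1/2) ^ l)"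
proof -
  obtain C where C: "\<And>l. mat_bound (jump l) (C * (1/2) ^ l)" using jump_bound by blast
  have "mat_bound (defect l) ((2 + 2 * C) * (1/2) ^ l)" for l
  proof -
    have "mat_bound (mat_add (mat_diff (commut (w_incr l) Ushift) (sandwich (wt l) (commut (incr l) Ushift)))
        (mat_add (sandwich (wt l) (mat_diff (commut (incr l) Ushift) (jump l)))
          (mat_diff (sandwich (wt l) (jump l)) (jump l))))
        ((1/2) ^ l + ((1/2) ^ l + (C * (1/2) ^ l + C * (1/2) ^ l)))"
      unfolding w_incr_def
      by (intro mat_bound_add mat_bound_diff wt(4,5) mat_bound_sandwich[OF C wt(1)] C)
    moreover have "mat_add (mat_diff (commut (w_incr l) Ushift) (sandwich (wt l) (commut (incr l) Ushift)))
        (mat_add (sandwich (wt l) (mat_diff (commut (incr l) Ushift) (jump l)))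
          (mat_diff (sandwich (wt l) (jump l)) (jump l))) = defect l"
      by (simp add: defect_def mat_add_def mat_diff_def sandwich_def algebra_simps)
    ultimately show ?thesis by (simp add: algebra_simps)
  qed
  then show ?thesis by blast
qed

lemma defect_summable: "summable (\<lambda>l. defect l i j)"
proof -
  obtain C where C: "\<And>l. mat_bound (defect l) (C * (1/2) ^ l)" using defect_bound by blast
  show ?thesis
    by (rule mat_series_summable[OF C]) (intro summable_mult summable_geometric, simp)
qed

definition defect_inf :: "nat mat" where
  "defect_inf = (\<lambda>i j. \<Sum>l. defect l i j)"

lemma defect_inf_compact: "defect_inf \<in> compact_ops"
proof -
  obtain C where C: "\<And>l. mat_bound (defect l) (C * (1/2) ^ l)" using defect_bound by blast
  let ?X = "{T :: nat mat. bounded_op T \<and> finite {(i, j). T i j \<noteq> 0}}"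
  have "mat_add R T \<in> ?X" if "R \<in> ?X" "T \<in> ?X" for R T
  proof -
    have "{(i, j). mat_add R T i j \<noteq> 0} \<subseteq> {(i, j). R i j \<noteq> 0} \<union> {(i, j). T i j \<noteq> 0}"
      by (auto simp: mat_add_def)
    then have "finite {(i, j). mat_add R T i j \<noteq> 0}"
      using that by (elim finite_subset) auto
    then show ?thesis using that by (auto simp: bounded_op_iff intro: mat_bound_add)
  qed
  moreover have "mat_zero \<in> ?X"
    using mat_bound_zero by (auto simp: bounded_op_iff mat_zero_def)
  moreover have "defect l \<in> norm_closure ?X" for l
    using defect_compact[of l] by (simp add: compact_ops_def)
  moreover have "summable (\<lambda>l. C * (1/2) ^ l)"
    by (intro summable_mult summable_geometric) simp
  ultimately show ?thesis
    unfolding defect_inf_def compact_ops_def using C by (intro norm_closure_series) auto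
qed

section \<open>The infinite implementing matrix\<close>

definition \<alpha>1 :: "nat mat" where
  "\<alpha>1 = (\<lambda>i j. \<Sum>l<i. w_incr l i j)"

text \<open>\<open>wt l\<close> vanishes up to l, so row i meets only the increments with l < i. The
  series is finite in each entry, whatever the norms of the increments.\<close>

lemma alpha1_eq: "i \<le> L \<Longrightarrow> \<alpha>1 i j = (\<Sum>l<L. w_incr l i j)"
  unfolding \<alpha>1_def by (rule sum.mono_neutral_left) (auto intro: w_incr_initial)

text \<open>Entry (i, j) of the commutator reads rows i and i - 1 only, so any L >= i increments
  compute it exactly. The jumps telescope, and the remainder \<open>q_cut (level L) - q_inf\<close>
  tends to 0.\<close>

lemma alpha1_commut_Ushift: "commut \<alpha>1 Ushift = mat_add (mat_diff q q_inf) defect_inf"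
proof (intro ext)
  fix i j
  obtain C where C: "\<And>l. mat_bound (mat_diff (q_cut (level l)) q_inf) (C * (1/2) ^ l)"
    using level(4) by blast
  have "(\<lambda>L. mat_diff (q_cut (level L)) q_inf i j) \<longlonglongrightarrow> 0"
  proof (rule Lim_null_comparison)
    show "eventually (\<lambda>L. cmod (mat_diff (q_cut (level L)) q_inf i j) \<le> C * (1/2) ^ L) sequentially"
      by (rule always_eventually, rule allI, rule mat_bound_entry[OF C])
    have "(\<lambda>L. C * (1/2) ^ L) \<longlonglongrightarrow> C * 0"
      by (intro tendsto_mult tendsto_const LIMSEQ_power_zero) simp
    then show "(\<lambda>L. C * (1/2) ^ L) \<longlonglongrightarrow> 0" by simp
  qed
  then have lim: "(\<lambda>L. q_cut (level L) i j - q_inf i j) \<longlonglongrightarrow> 0"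
    by (simp add: mat_diff_def)
  have part: "commut \<alpha>1 Ushift i j
      = (q i j - q_inf i j) - (q_cut (level L) i j - q_inf i j) + (\<Sum>l<L. defect l i j)"
    if L: "i \<le> L" for L
  proof -
    have "commut \<alpha>1 Ushift i j = (\<Sum>l<L. commut (w_incr l) Ushift i j)"
      unfolding commut_Ushift using L
      by (cases i) (simp_all add: alpha1_eq[of _ L] sum_subtractf)
    also have "\<dots> = (\<Sum>l<L. jump l i j + defect l i j)"
      by (simp add: defect_def mat_diff_def)
    also have "\<dots> = (\<Sum>l<L. q_cut (level l) i j - q_cut (level (Suc l)) i j) + (\<Sum>l<L. defect l i j)"
      by (simp add: sum.distrib jump_def mat_diff_def)
    also have "(\<Sum>l<L. q_cut (level l) i j - q_cut (level (Suc l)) i j) = q i j - q_cut (level L) i j"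
      using sum_lessThan_telescope'[of "\<lambda>l. q_cut (level l) i j" L] by (simp add: level(1) q_cut_zero)
    finally show ?thesis by simp
  qed
  have "(\<lambda>L. (q i j - q_inf i j) - (q_cut (level L) i j - q_inf i j) + (\<Sum>l<L. defect l i j))
      \<longlonglongrightarrow> (q i j - q_inf i j) - 0 + defect_inf i j"
    unfolding defect_inf_def by (intro tendsto_intros lim summable_LIMSEQ defect_summable)
  moreover have "(\<lambda>L. (q i j - q_inf i j) - (q_cut (level L) i j - q_inf i j) + (\<Sum>l<L. defect l i j))
      \<longlonglongrightarrow> commut \<alpha>1 Ushift i j"
  proof (rule tendsto_eventually)
    show "eventually (\<lambda>L. (q i j - q_inf i j) - (q_cut (level L) i j - q_inf i j) + (\<Sum>l<L. defect l i j)
        = commut \<alpha>1 Ushift i j) sequentially"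
      using eventually_ge_at_top[of i] by eventually_elim (rule part[symmetric])
  qed
  ultimately have "(q i j - q_inf i j) - 0 + defect_inf i j = commut \<alpha>1 Ushift i j"
    by (rule LIMSEQ_unique)
  then show "commut \<alpha>1 Ushift i j = mat_add (mat_diff q q_inf) defect_inf i j"
    by (simp add: mat_add_def mat_diff_def)
qed

text \<open>Solves \<open>commut \<alpha>2 Ushift = q_inf\<close> by summing down each diagonal;
  these sums may be unbounded. The values in column 0 are free and are set to 0 for the sake of
  \<open>alpha_column_zero\<close>.\<close>

fun \<alpha>2 :: "nat mat" where
  "\<alpha>2 i 0 = 0"
| "\<alpha>2 0 (Suc j) = q_inf 0 j"
| "\<alpha>2 (Suc i) (Suc j) = \<alpha>2 i j + q_inf (Suc i) j"

lemma alpha2_commut_Ushift: "commut \<alpha>2 Ushift = q_inf"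
  unfolding commut_Ushift by (intro ext) (simp split: nat.split)

lemma alpha2_support: "\<alpha>2 i j \<noteq> 0 \<Longrightarrow> int i - int j \<in> Sinf"
proof (induction i j rule: \<alpha>2.induct)
  case (2 j)
  then have "int 0 - int j - 1 \<in> Sinf"
    by (simp add: q_inf_def band_cut_def shifted_def split: if_splits)
  moreover have "int 0 - int (Suc j) = int 0 - int j - 1" by simp
  ultimately show ?case by (simp only:)
next
  case (3 i j)
  show ?case
  proof (cases "\<alpha>2 i j = 0")
    case True
    with 3 have "int (Suc i) - int j - 1 \<in> Sinf"
      by (simp add: q_inf_def band_cut_def shifted_def split: if_splits)
    moreover have "int (Suc i) - int (Suc j) = int (Suc i) - int j - 1" by simp
    ultimately show ?thesis by (simp only:)
  next
    case False
    with 3 show ?thesis by simp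
  qed
qed simp

definition \<alpha> :: "nat mat" where
  "\<alpha> = mat_add \<alpha>1 \<alpha>2"

section \<open>The derivation \<open>d\<close> on the generators\<close>

definition d :: "nat mat \<Rightarrow> nat mat" where
  "d = commut \<alpha>"

lemma d_Ushift: "d Ushift = mat_add q defect_inf"
proof -
  have "d Ushift = mat_add (commut \<alpha>1 Ushift) (commut \<alpha>2 Ushift)"
    unfolding d_def \<alpha>_def commut_Ushift
    by (intro ext) (simp add: mat_add_def split: nat.split)
  then show ?thesis
    unfolding alpha1_commut_Ushift alpha2_commut_Ushift by (simp add: mat_add_def mat_diff_def)
qed

lemma A_d_Ushift: "d Ushift \<in> A" and pi_d_Ushift: "\<pi> (d Ushift) = \<delta> Vshift"
proof -
  have s: "defect_inf \<in> A" "\<pi> defect_inf = mat_zero" using defect_inf_compact by (auto simp: compact_iff)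
  show "d Ushift \<in> A" unfolding d_Ushift by (intro A_add q s)
  show "\<pi> (d Ushift) = \<delta> Vshift"
    unfolding d_Ushift pi_add[OF q(1) s(1)] q(2) s(2) by (simp add: Q_def mat_add_def mat_zero_def)
qed

lemma alpha_column_zero: "\<alpha> i 0 = 0"
  by (simp add: \<alpha>_def mat_add_def \<alpha>1_def w_incr_initial)

text \<open>Only U*U = 1 is available, so d(U*) is determined by d(U) up to its first column; that column
  vanishes because the first column of the implementing matrix does.\<close>

lemma d_adj_Ushift:
  "d (mat_adj Ushift) = mat_scale (-1) (mat_mult (mat_adj Ushift) (mat_mult (d Ushift) (mat_adj Ushift)))"
proof (intro ext)
  fix i j
  show "d (mat_adj Ushift) i j
      = mat_scale (-1) (mat_mult (mat_adj Ushift) (mat_mult (d Ushift) (mat_adj Ushift))) i j"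
    unfolding d_def commut_def[of \<alpha> "mat_adj Ushift"] commut_Ushift
      mat_mult_adj_Ushift_left mat_mult_adj_Ushift_right mat_scale_def mat_diff_def
    by (cases j) (simp_all add: alpha_column_zero)
qed

text \<open>Follows from V^(-1) V = 1 and \<delta>(1) = 0. The form is that of
  \<open>d_adj_Ushift\<close>, so that \<pi> matches the two formulas term by term.\<close>

lemma delta_Vshift_inv:
  "\<delta> Vshift_inv = mat_scale (-1) (mat_mult Vshift_inv (mat_mult (\<delta> Vshift) Vshift_inv))"
proof -
  have "mat_mult Vshift_inv Vshift = diag (\<lambda>i. 1 powi i)"
    unfolding mat_mult_Vshift_inv_left by (intro ext) (simp add: Vshift_def diag_def)
  then have "\<delta> (mat_mult Vshift_inv Vshift) = mat_zero"
    using P_one by (simp add: P_def)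
  then have eq: "mat_add (mat_mult Vshift_inv (\<delta> Vshift)) (mat_mult (\<delta> Vshift_inv) Vshift) = mat_zero"
    using delta_mult[OF B0_Vshift_inv B0_Vshift] by simp
  show ?thesis
  proof (intro ext)
    fix i j
    have "mat_add (mat_mult Vshift_inv (\<delta> Vshift)) (mat_mult (\<delta> Vshift_inv) Vshift) i (j - 1) = 0"
      unfolding eq by (simp add: mat_zero_def)
    then have "\<delta> Vshift (i + 1) (j - 1) + \<delta> Vshift_inv i j = 0"
      unfolding mat_add_def mat_mult_Vshift_inv_left mat_mult_Vshift_right by simp
    then show "\<delta> Vshift_inv i j
        = mat_scale (-1) (mat_mult Vshift_inv (mat_mult (\<delta> Vshift) Vshift_inv)) i j"
      unfolding mat_scale_def mat_mult_Vshift_inv_left mat_mult_Vshift_inv_right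
      by (simp add: add_eq_0_iff)
  qed
qed

lemma A_d_adj_Ushift: "d (mat_adj Ushift) \<in> A"
  and pi_d_adj_Ushift: "\<pi> (d (mat_adj Ushift)) = \<delta> Vshift_inv"
proof -
  have U: "mat_adj Ushift \<in> A" "\<pi> (mat_adj Ushift) = Vshift_inv"
    using A_Ushift by (auto simp: A_adj pi_adj pi_Ushift mat_adj_Vshift)
  show "d (mat_adj Ushift) \<in> A"
    unfolding d_adj_Ushift by (intro A_scale A_mult U A_d_Ushift)
  show "\<pi> (d (mat_adj Ushift)) = \<delta> Vshift_inv"
    unfolding d_adj_Ushift delta_Vshift_inv
    by (simp add: pi_scale pi_mult A_mult U A_d_Ushift pi_d_Ushift)
qed

text \<open>For z in \<open>F (level n)\<close>, both \<alpha>2 and the increments with l >= n live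
  on diagonals in \<open>S (level n)\<close>, where diag(z^i) commutes with everything. So \<alpha>
  may be replaced by the partial sum g in \<open>A\<close>, whose symbol telescopes to
  \<open>impl_symbol (level n)\<close> and implements \<delta> on M_z.\<close>

lemma
  assumes z: "z \<in> Z"
  shows A_d_diag: "d (diag (\<lambda>i. z ^ i)) \<in> A"
    and pi_d_diag: "\<pi> (d (diag (\<lambda>i. z ^ i))) = \<delta> (diag (\<lambda>i. z powi i))"
proof -
  have z0: "z \<noteq> 0" by (rule Z_nonzero[OF z])
  obtain n where "z \<in> F n" using Z_eq_Union_F[OF z] by blast
  then have zF: "z \<in> F (level n)" using F_mono[OF level(3)] by blast
  have same: "z ^ i = z ^ j" if "int i - int j \<in> S (level n)" for i j
    using that zF z0 by (auto simp: S_def power_int_diff)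
  define g where "g = (\<lambda>i j. \<Sum>l<n. w_incr l i j)"
  have g: "g \<in> A" "\<pi> g = impl_symbol (level n)"
  proof -
    show "g \<in> A" unfolding g_def by (intro A_sum A_w_incr)
    have "\<pi> g = (\<lambda>i j. \<Sum>l<n. \<pi> (w_incr l) i j)" unfolding g_def by (intro pi_sum A_w_incr)
    also have "\<dots> = (\<lambda>i j. \<Sum>l<n. impl_symbol (level (Suc l)) i j - impl_symbol (level l) i j)"
      unfolding pi_w_incr pi_incr mat_diff_def ..
    also have "\<dots> = impl_symbol (level n)"
      unfolding sum_lessThan_telescope[of "\<lambda>l. impl_symbol (level l) _ _"]
      by (simp add: level(1) impl_symbol_zero mat_zero_def)
    finally show "\<pi> g = impl_symbol (level n)" .
  qed
  have eq: "d (diag (\<lambda>i. z ^ i)) = commut g (diag (\<lambda>i. z ^ i))"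
  proof (intro ext)
    fix i j
    show "d (diag (\<lambda>i. z ^ i)) i j = commut g (diag (\<lambda>i. z ^ i)) i j"
    proof (cases "int i - int j \<in> S (level n)")
      case True
      then show ?thesis using same by (simp add: d_def commut_diag)
    next
      case False
      have "\<alpha>2 i j = 0" using alpha2_support[of i j] False by (auto simp: Sinf_def)
      moreover have "\<alpha>1 i j = g i j"
      proof -
        have "\<alpha>1 i j = (\<Sum>l<max i n. w_incr l i j)" by (rule alpha1_eq) simp
        also have "\<dots> = g i j"
          unfolding g_def
        proof (rule sum.mono_neutral_right)
          have "w_incr l i j = 0" if "n \<le> l" for l
            using w_incr_support[of l i j] S_antimono[OF monoD[OF level(2) that]] False by blast
          then show "\<forall>l\<in>{..<max i n} - {..<n}. w_incr l i j = 0" by auto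
        qed auto
        finally show ?thesis .
      qed
      ultimately show ?thesis by (simp add: d_def commut_diag \<alpha>_def mat_add_def)
    qed
  qed
  note D = A_diag_power[OF z] pi_diag_power[OF z]
  show "d (diag (\<lambda>i. z ^ i)) \<in> A" unfolding eq by (intro A_commut g D)
  have "\<pi> (commut g (diag (\<lambda>i. z ^ i)))
      = mat_diff (mat_mult (\<pi> g) (diag (\<lambda>i. z powi i))) (mat_mult (diag (\<lambda>i. z powi i)) (\<pi> g))"
    unfolding commut_def by (simp add: pi_diff pi_mult A_mult g D)
  also have "\<dots> = P z"
  proof (intro ext)
    fix i j
    show "mat_diff (mat_mult (\<pi> g) (diag (\<lambda>i. z powi i))) (mat_mult (diag (\<lambda>i. z powi i)) (\<pi> g)) i j
        = P z i j"
      unfolding g(2) mat_mult_diag_left mat_mult_diag_right mat_diff_def impl_symbol_diag[OF zF, symmetric]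
      by (simp add: algebra_simps)
  qed
  finally show "\<pi> (d (diag (\<lambda>i. z ^ i))) = \<delta> (diag (\<lambda>i. z powi i))"
    unfolding eq P_def .
qed

text \<open>Invariant for the induction over \<open>Aalg0 x1\<close>: bandedness gives access to the
  laws of \<open>commut\<close>, and membership of \<open>\<pi> x\<close> in \<open>B0\<close> to
  those of \<delta>.\<close>

definition good :: "nat mat \<Rightarrow> bool" where
  "good x \<longleftrightarrow> banded x \<and> x \<in> A \<and> \<pi> x \<in> B0 \<and> d x \<in> A \<and> \<pi> (d x) = \<delta> (\<pi> x)"

lemma good_add: "good x \<Longrightarrow> good y \<Longrightarrow> good (mat_add x y)"
  unfolding good_def d_def
  by (auto simp: banded_add A_add pi_add commut_add delta_add Balg0_def intro: star_alg.add)

lemma good_scale: "good x \<Longrightarrow> good (mat_scale k x)"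
  unfolding good_def d_def
  by (auto simp: banded_scale A_scale pi_scale commut_scale delta_scale Balg0_def intro: star_alg.scale)

lemma good_mult: "good x \<Longrightarrow> good y \<Longrightarrow> good (mat_mult x y)"
  unfolding good_def d_def
  by (auto simp: banded_mult A_mult A_add pi_mult pi_add commut_mult delta_mult B0_mult)

lemma good_Ushift: "good Ushift"
  unfolding good_def using A_Ushift
  by (simp add: banded_Ushift pi_Ushift B0_Vshift A_d_Ushift pi_d_Ushift)

lemma good_adj_Ushift: "good (mat_adj Ushift)"
  unfolding good_def using A_Ushift
  by (simp add: banded_Ushift banded_adj A_adj pi_adj pi_Ushift mat_adj_Vshift B0_Vshift_inv
      A_d_adj_Ushift pi_d_adj_Ushift)

lemma good_diag: "z \<in> Z \<Longrightarrow> good (diag (\<lambda>i. z ^ i))"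
  unfolding good_def
  by (simp add: banded_diag A_diag_power pi_diag_power B0_diag_power A_d_diag pi_d_diag)

lemma mat_adj_adj: "mat_adj (mat_adj x) = x"
  by (simp add: mat_adj_def)

text \<open>The adjoint is carried along in the induction because d need not be a star map.\<close>

lemma good_Aalg0:
  assumes "x \<in> Aalg0 x1"
  shows "good x \<and> good (mat_adj x)"
  using assms unfolding Aalg0_def
proof (induction rule: star_alg.induct)
  case (gen T)
  then consider "T = Ushift" | "T = mat_adj Ushift" | ch where "character ch" "T = Mplus x1 ch"
    by auto
  then show ?case
  proof cases
    case 3
    define z where "z = ch x1"
    have z: "z \<in> Z" using 3(1) by (auto simp: Z_def z_def)
    have T: "T = diag (\<lambda>i. z ^ i)" using Mplus_character[OF 3(1)] 3(2) by (simp add: z_def)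
    \<comment> \<open>On the unit circle conjugation is inversion, so the adjoint of the generator
      for z is the generator for the inverse of z.\<close>
    have "z * cnj z = 1"
      using complex_norm_square[of z] Z_norm[OF z] by simp
    then have "cnj z = inverse z" by (rule inverse_unique[symmetric])
    then have "mat_adj T = diag (\<lambda>i. inverse z ^ i)"
      unfolding T mat_adj_diag complex_cnj_power by simp
    then show ?thesis using good_diag[OF z] good_diag[OF Z_inverse[OF z]] T by simp
  qed (simp_all add: good_Ushift good_adj_Ushift mat_adj_adj)
next
  case (add T T')
  have "mat_adj (mat_add T T') = mat_add (mat_adj T) (mat_adj T')"
    by (simp add: mat_adj_def mat_add_def)
  with add show ?case by (simp add: good_add)
next
  case (scale T k)
  have "mat_adj (mat_scale k T) = mat_scale (cnj k) (mat_adj T)"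
    by (simp add: mat_adj_def mat_scale_def)
  with scale show ?case by (simp add: good_scale)
next
  case (mult T T')
  then show ?case by (simp add: good_mult mat_adj_mult)
next
  case (adj T)
  then show ?case by (simp add: mat_adj_adj)
qed

lemma d_lifts: "is_derivation (Aalg0 x1) A d" "x \<in> Aalg0 x1 \<Longrightarrow> \<pi> (d x) = \<delta> (\<pi> x)"
proof -
  have good: "x \<in> Aalg0 x1 \<Longrightarrow> good x" for x using good_Aalg0 by blast
  show "is_derivation (Aalg0 x1) A d"
    unfolding is_derivation_def using good
    by (auto simp: good_def d_def commut_add commut_scale commut_mult)
  show "x \<in> Aalg0 x1 \<Longrightarrow> \<pi> (d x) = \<delta> (\<pi> x)"
    using good[of x] by (simp add: good_def)
qed

end

theorem theorem4p6:
  fixes x1 :: "'g::{topological_ab_group_add, t2_space}"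
    and \<pi> :: "nat mat \<Rightarrow> int mat"
    and \<delta> :: "int mat \<Rightarrow> int mat"
  assumes "compact (UNIV :: 'g set)"
    and "infinite (UNIV :: 'g set)"
    and "totally_disconnected_space TYPE('g)"
    and "closure (range (orb x1)) = UNIV"
    and "is_symbol_map x1 \<pi>"
    and "is_derivation (Balg0 x1) (Balg x1) \<delta>"
  shows "\<exists>d. is_derivation (Aalg0 x1) (Aalg x1) d \<and>
             (\<forall>a\<in>Aalg0 x1. \<pi> (d a) = \<delta> (\<pi> a))"
proof -
  interpret derivation_lifting x1 \<pi> \<delta>
    by unfold_locales (use assms in auto)
  show ?thesis using d_lifts by blast
qed

end
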